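(* Let $\mathsf{C}$ be a homological (in particular regular) category, let $\mathsf{X}$ be a full replete reflective subcategory of $\mathsf{C}$ with reflection $F:\mathsf{C}\to\mathsf{X}$ (the left adjoint of the inclusion). Let $\mathsf{Y}$ be the full subcategory of $\mathsf{C}$ whose objects are those $Y\in\mathsf{C}$ for which there is a monomorphism $Y\to X$ in $\mathsf{C}$ with $X\in\mathsf{X}$, and let $F':\mathsf{C}\to\mathsf{Y}$ and $F'':\mathsf{Y}\to\mathsf{X}$ be the left adjoints of the inclusions $\mathsf{Y}\to\mathsf{C}$ and $\mathsf{X}\to\mathsf{Y}$ respectively (so that $F\cong F''F'$, where $F'$ is a (regular epi)-reflection and $F''$ is a monoreflection). Then $F$ is a protoadditive reflection if and only if both $F'$ and $F''$ are protoadditive reflections.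
   Context: A category is regular if it is finitely complete, every arrow factors as a regular epimorphism followed by a monomorphism, and these factorizations are pullback-stable. A category is homological if it is finitely complete, pointed, regular and protomodular. A pointed finitely complete category is protomodular if, for every morphism of split short exact data $(u,v,w):(K\xrightarrow{k}A\underset{s}{\overset{f}{\rightleftarrows}}B)\to(K'\xrightarrow{k'}A'\underset{s'}{\overset{f'}{\rightleftarrows}}B')$ with $k=\ker f$, $k'=\ker f'$, $fs=1_B$, $f's'=1_{B'}$, and commuting with all the structure maps, $v$ is an isomorphism whenever $u$ and $w$ are. A short exact sequence $0\to K\xrightarrow{k}A\xrightarrow{f}B\to0$ in a pointed category is a pair with $k=\ker(f)$ and $f=\operatorname{coker}(k)$ in that category; it is split if a morphism $s:B\to A$ with $fs=1_B$ is given. A reflection $F:\mathsf{C}\to\mathsf{X}$ onto a full replete subcategory is protoadditive if, for every split short exact sequence $0\to K\xrightarrow{k}A\underset{s}{\overset{f}{\rightleftarrows}}B\to0$ in $\mathsf{C}$, the sequence $0\to F(K)\xrightarrow{F(k)}F(A)\xrightarrow{F(f)}F(B)\to0$ (split by $F(s)$) is a short exact sequence in $\mathsf{X}$. A reflection is a (regular epi)-reflection (resp. monoreflection) if every component of its unit is a regular epimorphism (resp. monomorphism). *)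

theory Defs
  imports Main
begin

section \<open>Categories and full subcategories\<close>

record ('o, 'm) cat =
  Ob :: "'o set"
  Ar :: "'m set"
  Dom :: "'m \<Rightarrow> 'o"
  Cod :: "'m \<Rightarrow> 'o"
  Id :: "'o \<Rightarrow> 'm"
  comp :: "'m \<Rightarrow> 'm \<Rightarrow> 'm" (infixl "\<cdot>\<index>" 70)

definition hom :: "('o, 'm) cat \<Rightarrow> 'o \<Rightarrow> 'o \<Rightarrow> 'm set" where
  "hom C A B = {f \<in> Ar C. Dom C f = A \<and> Cod C f = B}"

text \<open>Composition is written in the usual order: in \<open>g \<cdot> f\<close> the arrow \<open>f\<close> comes first. The
  operations are constrained only on \<open>Ob C\<close>, on \<open>Ar C\<close> and on composable pairs.\<close>

locale category =
  fixes C :: "('o, 'm) cat" (structure)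
  assumes Dom_in_Ob: "f \<in> Ar C \<Longrightarrow> Dom C f \<in> Ob C"
    and Cod_in_Ob: "f \<in> Ar C \<Longrightarrow> Cod C f \<in> Ob C"
    and Id_in_hom: "A \<in> Ob C \<Longrightarrow> Id C A \<in> hom C A A"
    and comp_in_hom: "f \<in> hom C A B \<Longrightarrow> g \<in> hom C B D \<Longrightarrow> g \<cdot> f \<in> hom C A D"
    and comp_Id_left: "f \<in> hom C A B \<Longrightarrow> Id C B \<cdot> f = f"
    and comp_Id_right: "f \<in> hom C A B \<Longrightarrow> f \<cdot> Id C A = f"
    and comp_assoc: "f \<in> hom C A B \<Longrightarrow> g \<in> hom C B D \<Longrightarrow> h \<in> hom C D E \<Longrightarrow>
      (h \<cdot> g) \<cdot> f = h \<cdot> (g \<cdot> f)"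

definition isomorphism :: "('o, 'm) cat \<Rightarrow> 'm \<Rightarrow> bool" where
  "isomorphism C f \<longleftrightarrow> f \<in> Ar C \<and>
    (\<exists>g \<in> hom C (Cod C f) (Dom C f).
      g \<cdot>\<^bsub>C\<^esub> f = Id C (Dom C f) \<and> f \<cdot>\<^bsub>C\<^esub> g = Id C (Cod C f))"

definition monic :: "('o, 'm) cat \<Rightarrow> 'm \<Rightarrow> bool" where
  "monic C m \<longleftrightarrow> m \<in> Ar C \<and>
    (\<forall>A. \<forall>f \<in> hom C A (Dom C m). \<forall>g \<in> hom C A (Dom C m).
      m \<cdot>\<^bsub>C\<^esub> f = m \<cdot>\<^bsub>C\<^esub> g \<longrightarrow> f = g)"

definition coequalizer :: "('o, 'm) cat \<Rightarrow> 'm \<Rightarrow> 'm \<Rightarrow> 'm \<Rightarrow> bool" where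
  "coequalizer C f g q \<longleftrightarrow> f \<in> Ar C \<and> g \<in> hom C (Dom C f) (Cod C f) \<and>
    q \<in> Ar C \<and> Dom C q = Cod C f \<and> q \<cdot>\<^bsub>C\<^esub> f = q \<cdot>\<^bsub>C\<^esub> g \<and>
    (\<forall>h \<in> Ar C. Dom C h = Cod C f \<and> h \<cdot>\<^bsub>C\<^esub> f = h \<cdot>\<^bsub>C\<^esub> g \<longrightarrow>
      (\<exists>!u. u \<in> hom C (Cod C q) (Cod C h) \<and> u \<cdot>\<^bsub>C\<^esub> q = h))"

definition regular_epi :: "('o, 'm) cat \<Rightarrow> 'm \<Rightarrow> bool" where
  "regular_epi C q \<longleftrightarrow> (\<exists>f g. coequalizer C f g q)"

definition full_subcategory :: "('o, 'm) cat \<Rightarrow> 'o set \<Rightarrow> ('o, 'm) cat" where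
  "full_subcategory C S =
    C\<lparr>Ob := S, Ar := {f \<in> Ar C. Dom C f \<in> S \<and> Cod C f \<in> S}\<rparr>"

definition replete :: "('o, 'm) cat \<Rightarrow> 'o set \<Rightarrow> bool" where
  "replete C S \<longleftrightarrow>
    (\<forall>f. isomorphism C f \<and> Dom C f \<in> S \<longrightarrow> Cod C f \<in> S)"


section \<open>Functors and adjunctions\<close>

record ('o, 'm, 'p, 'n) func =
  on_ob :: "'o \<Rightarrow> 'p"
  on_ar :: "'m \<Rightarrow> 'n"

locale is_functor = C: category C + D: category D
  for C :: "('o, 'm) cat" and D :: "('p, 'n) cat" +
  fixes F :: "('o, 'm, 'p, 'n) func"
  assumes on_ob_in_Ob: "A \<in> Ob C \<Longrightarrow> on_ob F A \<in> Ob D"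
    and on_ar_in_hom: "f \<in> hom C A B \<Longrightarrow> on_ar F f \<in> hom D (on_ob F A) (on_ob F B)"
    and on_ar_Id: "A \<in> Ob C \<Longrightarrow> on_ar F (Id C A) = Id D (on_ob F A)"
    and on_ar_comp: "f \<in> hom C A B \<Longrightarrow> g \<in> hom C B E \<Longrightarrow>
      on_ar F (g \<cdot>\<^bsub>C\<^esub> f) = on_ar F g \<cdot>\<^bsub>D\<^esub> on_ar F f"

text \<open>\<open>id_func\<close> also serves as the inclusion functor of a full subcategory.\<close>

definition id_func :: "('o, 'm, 'o, 'm) func" where
  "id_func = \<lparr>on_ob = (\<lambda>A. A), on_ar = (\<lambda>f. f)\<rparr>"

definition comp_func ::
  "('p, 'n, 'q, 'k) func \<Rightarrow> ('o, 'm, 'p, 'n) func \<Rightarrow> ('o, 'm, 'q, 'k) func" where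
  "comp_func G F = \<lparr>on_ob = on_ob G \<circ> on_ob F, on_ar = on_ar G \<circ> on_ar F\<rparr>"

locale natural_transformation = F: is_functor C D F + G: is_functor C D G
  for C :: "('o, 'm) cat" and D :: "('p, 'n) cat"
    and F :: "('o, 'm, 'p, 'n) func" and G :: "('o, 'm, 'p, 'n) func" +
  fixes \<tau> :: "'o \<Rightarrow> 'n"
  assumes component_in_hom: "A \<in> Ob C \<Longrightarrow> \<tau> A \<in> hom D (on_ob F A) (on_ob G A)"
    and naturality: "f \<in> hom C A B \<Longrightarrow>
      \<tau> B \<cdot>\<^bsub>D\<^esub> on_ar F f = on_ar G f \<cdot>\<^bsub>D\<^esub> \<tau> A"

definition naturally_isomorphic ::
  "('o, 'm) cat \<Rightarrow> ('p, 'n) cat \<Rightarrow> ('o, 'm, 'p, 'n) func \<Rightarrow> ('o, 'm, 'p, 'n) func \<Rightarrow> bool" where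
  "naturally_isomorphic C D F G \<longleftrightarrow>
    (\<exists>\<tau>. natural_transformation C D F G \<tau> \<and> (\<forall>A \<in> Ob C. isomorphism D (\<tau> A)))"

text \<open>\<open>F : C \<rightarrow> D\<close> is left adjoint to \<open>G : D \<rightarrow> C\<close> with unit \<open>\<eta>\<close>.\<close>

locale adjunction =
  F: is_functor C D F + G: is_functor D C G +
  unit: natural_transformation C C id_func "comp_func G F" \<eta>
  for C :: "('o, 'm) cat" and D :: "('p, 'n) cat"
    and F :: "('o, 'm, 'p, 'n) func" and G :: "('p, 'n, 'o, 'm) func"
    and \<eta> :: "'o \<Rightarrow> 'm" +
  assumes unit_universal: "A \<in> Ob C \<Longrightarrow> B \<in> Ob D \<Longrightarrow> f \<in> hom C A (on_ob G B) \<Longrightarrow>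
    \<exists>!g. g \<in> hom D (on_ob F A) B \<and> on_ar G g \<cdot>\<^bsub>C\<^esub> \<eta> A = f"

definition reflection ::
  "('o, 'm) cat \<Rightarrow> 'o set \<Rightarrow> ('o, 'm, 'o, 'm) func \<Rightarrow> ('o \<Rightarrow> 'm) \<Rightarrow> bool" where
  "reflection C S F \<eta> \<longleftrightarrow> S \<subseteq> Ob C \<and> replete C S \<and>
    adjunction C (full_subcategory C S) F id_func \<eta>"

definition regular_epi_reflection ::
  "('o, 'm) cat \<Rightarrow> 'o set \<Rightarrow> ('o, 'm, 'o, 'm) func \<Rightarrow> ('o \<Rightarrow> 'm) \<Rightarrow> bool" where
  "regular_epi_reflection C S F \<eta> \<longleftrightarrow>
    reflection C S F \<eta> \<and> (\<forall>A \<in> Ob C. regular_epi C (\<eta> A))"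

definition monoreflection ::
  "('o, 'm) cat \<Rightarrow> 'o set \<Rightarrow> ('o, 'm, 'o, 'm) func \<Rightarrow> ('o \<Rightarrow> 'm) \<Rightarrow> bool" where
  "monoreflection C S F \<eta> \<longleftrightarrow>
    reflection C S F \<eta> \<and> (\<forall>A \<in> Ob C. monic C (\<eta> A))"


section \<open>Finite completeness and regularity\<close>

definition cone ::
  "('i, 'j) cat \<Rightarrow> ('o, 'm) cat \<Rightarrow> ('i, 'j, 'o, 'm) func \<Rightarrow> 'o \<Rightarrow> ('i \<Rightarrow> 'm) \<Rightarrow> bool" where
  "cone J C D L \<pi> \<longleftrightarrow> L \<in> Ob C \<and>
    (\<forall>i \<in> Ob J. \<pi> i \<in> hom C L (on_ob D i)) \<and>
    (\<forall>a \<in> Ar J. on_ar D a \<cdot>\<^bsub>C\<^esub> \<pi> (Dom J a) = \<pi> (Cod J a))"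

definition limit_cone ::
  "('i, 'j) cat \<Rightarrow> ('o, 'm) cat \<Rightarrow> ('i, 'j, 'o, 'm) func \<Rightarrow> 'o \<Rightarrow> ('i \<Rightarrow> 'm) \<Rightarrow> bool" where
  "limit_cone J C D L \<pi> \<longleftrightarrow> cone J C D L \<pi> \<and>
    (\<forall>M \<mu>. cone J C D M \<mu> \<longrightarrow>
      (\<exists>!u. u \<in> hom C M L \<and> (\<forall>i \<in> Ob J. \<pi> i \<cdot>\<^bsub>C\<^esub> u = \<mu> i)))"

text \<open>Every finite category is isomorphic to one whose objects and arrows are natural numbers,
  so these index categories suffice.\<close>

definition finitely_complete :: "('o, 'm) cat \<Rightarrow> bool" where
  "finitely_complete C \<longleftrightarrow>
    (\<forall>(J :: (nat, nat) cat) D.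
      finite (Ob J) \<and> finite (Ar J) \<and> is_functor J C D \<longrightarrow> (\<exists>L \<pi>. limit_cone J C D L \<pi>))"

text \<open>\<open>pullback C f g p q\<close>: the square \<open>f \<cdot> p = g \<cdot> q\<close> is a pullback.\<close>

definition pullback :: "('o, 'm) cat \<Rightarrow> 'm \<Rightarrow> 'm \<Rightarrow> 'm \<Rightarrow> 'm \<Rightarrow> bool" where
  "pullback C f g p q \<longleftrightarrow> f \<in> Ar C \<and> g \<in> Ar C \<and> Cod C f = Cod C g \<and>
    p \<in> Ar C \<and> Cod C p = Dom C f \<and> q \<in> hom C (Dom C p) (Dom C g) \<and>
    f \<cdot>\<^bsub>C\<^esub> p = g \<cdot>\<^bsub>C\<^esub> q \<and>
    (\<forall>Z. \<forall>a \<in> hom C Z (Dom C f). \<forall>b \<in> hom C Z (Dom C g).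
      f \<cdot>\<^bsub>C\<^esub> a = g \<cdot>\<^bsub>C\<^esub> b \<longrightarrow>
      (\<exists>!u. u \<in> hom C Z (Dom C p) \<and> p \<cdot>\<^bsub>C\<^esub> u = a \<and> q \<cdot>\<^bsub>C\<^esub> u = b))"

definition regular_factorization :: "('o, 'm) cat \<Rightarrow> 'm \<Rightarrow> 'm \<Rightarrow> 'm \<Rightarrow> bool" where
  "regular_factorization C f e m \<longleftrightarrow> regular_epi C e \<and> monic C m \<and>
    Cod C e = Dom C m \<and> f = m \<cdot>\<^bsub>C\<^esub> e"

text \<open>In the stability clause \<open>m'\<close> is the pullback of \<open>m\<close> along \<open>g\<close>, with projection \<open>g\<^sub>1\<close> to the
  image, and \<open>e'\<close> is the pullback of \<open>e\<close> along \<open>g\<^sub>1\<close>, so \<open>m' \<cdot> e'\<close> is the pullback of \<open>f = m \<cdot> e\<close>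
  along \<open>g\<close>.\<close>

definition regular_category :: "('o, 'm) cat \<Rightarrow> bool" where
  "regular_category C \<longleftrightarrow> category C \<and> finitely_complete C \<and>
    (\<forall>f \<in> Ar C. \<exists>e m. regular_factorization C f e m) \<and>
    (\<forall>f e m g m' g\<^sub>1 e' g\<^sub>2.
      regular_factorization C f e m \<and> pullback C m g g\<^sub>1 m' \<and> pullback C e g\<^sub>1 g\<^sub>2 e' \<longrightarrow>
      regular_factorization C (m' \<cdot>\<^bsub>C\<^esub> e') e' m')"


section \<open>Pointed, protomodular and homological categories\<close>

definition zero_object :: "('o, 'm) cat \<Rightarrow> 'o \<Rightarrow> bool" where
  "zero_object C Z \<longleftrightarrow> Z \<in> Ob C \<and>
    (\<forall>A \<in> Ob C. (\<exists>!f. f \<in> hom C A Z) \<and> (\<exists>!f. f \<in> hom C Z A))"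

definition pointed :: "('o, 'm) cat \<Rightarrow> bool" where
  "pointed C \<longleftrightarrow> (\<exists>Z. zero_object C Z)"

definition zero_arrow :: "('o, 'm) cat \<Rightarrow> 'm \<Rightarrow> bool" where
  "zero_arrow C f \<longleftrightarrow> f \<in> Ar C \<and>
    (\<exists>Z. zero_object C Z \<and>
      (\<exists>a \<in> hom C (Dom C f) Z. \<exists>b \<in> hom C Z (Cod C f). f = b \<cdot>\<^bsub>C\<^esub> a))"

definition is_kernel :: "('o, 'm) cat \<Rightarrow> 'm \<Rightarrow> 'm \<Rightarrow> bool" where
  "is_kernel C k f \<longleftrightarrow> k \<in> Ar C \<and> f \<in> Ar C \<and> Cod C k = Dom C f \<and>
    zero_arrow C (f \<cdot>\<^bsub>C\<^esub> k) \<and>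
    (\<forall>h \<in> Ar C. Cod C h = Dom C f \<and> zero_arrow C (f \<cdot>\<^bsub>C\<^esub> h) \<longrightarrow>
      (\<exists>!u. u \<in> hom C (Dom C h) (Dom C k) \<and> k \<cdot>\<^bsub>C\<^esub> u = h))"

definition is_cokernel :: "('o, 'm) cat \<Rightarrow> 'm \<Rightarrow> 'm \<Rightarrow> bool" where
  "is_cokernel C f k \<longleftrightarrow> f \<in> Ar C \<and> k \<in> Ar C \<and> Dom C f = Cod C k \<and>
    zero_arrow C (f \<cdot>\<^bsub>C\<^esub> k) \<and>
    (\<forall>h \<in> Ar C. Dom C h = Cod C k \<and> zero_arrow C (h \<cdot>\<^bsub>C\<^esub> k) \<longrightarrow>
      (\<exists>!u. u \<in> hom C (Cod C f) (Cod C h) \<and> u \<cdot>\<^bsub>C\<^esub> f = h))"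

definition short_exact :: "('o, 'm) cat \<Rightarrow> 'm \<Rightarrow> 'm \<Rightarrow> bool" where
  "short_exact C k f \<longleftrightarrow> is_kernel C k f \<and> is_cokernel C f k"

definition section_of :: "('o, 'm) cat \<Rightarrow> 'm \<Rightarrow> 'm \<Rightarrow> bool" where
  "section_of C s f \<longleftrightarrow> f \<in> Ar C \<and> s \<in> hom C (Cod C f) (Dom C f) \<and>
    f \<cdot>\<^bsub>C\<^esub> s = Id C (Cod C f)"

definition split_short_exact :: "('o, 'm) cat \<Rightarrow> 'm \<Rightarrow> 'm \<Rightarrow> 'm \<Rightarrow> bool" where
  "split_short_exact C k f s \<longleftrightarrow> short_exact C k f \<and> section_of C s f"

definition protomodular :: "('o, 'm) cat \<Rightarrow> bool" where
  "protomodular C \<longleftrightarrow>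
    (\<forall>k f s k' f' s' u v w.
      is_kernel C k f \<and> section_of C s f \<and> is_kernel C k' f' \<and> section_of C s' f' \<and>
      u \<in> hom C (Dom C k) (Dom C k') \<and> v \<in> hom C (Dom C f) (Dom C f') \<and>
      w \<in> hom C (Cod C f) (Cod C f') \<and>
      v \<cdot>\<^bsub>C\<^esub> k = k' \<cdot>\<^bsub>C\<^esub> u \<and> w \<cdot>\<^bsub>C\<^esub> f = f' \<cdot>\<^bsub>C\<^esub> v \<and> v \<cdot>\<^bsub>C\<^esub> s = s' \<cdot>\<^bsub>C\<^esub> w \<and>
      isomorphism C u \<and> isomorphism C w \<longrightarrow> isomorphism C v)"

definition homological :: "('o, 'm) cat \<Rightarrow> bool" where
  "homological C \<longleftrightarrow> category C \<and> finitely_complete C \<and> pointed C \<and>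
    regular_category C \<and> protomodular C"


section \<open>Protoadditive reflections\<close>

text \<open>Exactness of the image sequence is tested in the subcategory itself; \<open>on_ar F s\<close> is
  automatically a section of \<open>on_ar F f\<close>.\<close>

definition protoadditive_reflection ::
  "('o, 'm) cat \<Rightarrow> 'o set \<Rightarrow> ('o, 'm, 'o, 'm) func \<Rightarrow> ('o \<Rightarrow> 'm) \<Rightarrow> bool" where
  "protoadditive_reflection C S F \<eta> \<longleftrightarrow> reflection C S F \<eta> \<and>
    (\<forall>k f s. split_short_exact C k f s \<longrightarrow>
      short_exact (full_subcategory C S) (on_ar F k) (on_ar F f))"

definition subobject_closure :: "('o, 'm) cat \<Rightarrow> 'o set \<Rightarrow> 'o set" where
  "subobject_closure C S =
    {Y \<in> Ob C. \<exists>X \<in> S. \<exists>m \<in> hom C Y X. monic C m}"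

end

theory Submission
  imports Defs
begin

text \<open>The two reflections arise from the image factorization \<open>A \<rightarrow> F' A \<rightarrow> F A\<close> of the unit of \<open>F\<close>: the
  image is a subobject of an object of \<open>X\<close>, and it is universal because regular epimorphisms are
  orthogonal to monomorphisms (\<open>reflection_subobject_closure_exists\<close>). On \<open>Y\<close>, the reflection
  \<open>F\<close> itself restricts to a reflection onto \<open>X\<close>, and its unit is monic there because some
  monomorphism factors through it (\<open>reflection_unit_monic\<close>). Any two reflections onto the same
  subcategory are naturally isomorphic, so every statement about \<open>F'\<close>, \<open>F''\<close> and \<open>F'' F'\<close> may be
  transported along these isomorphisms (\<open>protoadditive_reflection_unique\<close>).

  One half of the equivalence is composition of functors: functors preserve sections, so \<open>F'\<close>
  produces split short exact sequences of \<open>Y\<close>, to which \<open>F''\<close> applies.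

  For the other half, let \<open>F\<close> be protoadditive. The basic fact is that the kernel and the section of
  a split epimorphism are jointly strongly epic in a protomodular category
  (\<open>kernel_section_strongly_epic\<close>); in particular a split epimorphism is the cokernel of its kernel.
  Since kernels in a reflective subcategory are kernels in \<open>C\<close>, a split short exact sequence of \<open>Y\<close>
  is therefore one of \<open>C\<close>, which gives protoadditivity of \<open>F''\<close>, the restriction of \<open>F\<close>. For
  \<open>F'\<close>, take a split short exact sequence with kernel \<open>k : K \<rightarrow> A\<close> and quotient \<open>f : A \<rightarrow> B\<close>. As
  \<open>F k\<close> is a kernel and \<open>F' \<rightarrow> F\<close> is monic, \<open>F' k\<close> is monic, hence a subobject of the kernel \<open>L\<close>
  of \<open>F' f\<close>. The units at \<open>A\<close> and \<open>B\<close> are regular epimorphisms, which makes \<open>K \<rightarrow> L\<close> a regular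
  epimorphism; it factors through \<open>F' K\<close>, so \<open>F' K\<close> is all of \<open>L\<close>
  (\<open>kernel_of_split_quotient\<close>).\<close>

section \<open>Arrows of a category\<close>

context category
begin

lemma arrow_in_hom: "f \<in> Ar C \<Longrightarrow> f \<in> hom C (Dom C f) (Cod C f)"
  by (simp add: hom_def)

lemma comp_arrow [simp]:
  assumes "f \<in> Ar C" "g \<in> Ar C" "Dom C g = Cod C f"
  shows "g \<cdot> f \<in> Ar C" "Dom C (g \<cdot> f) = Dom C f" "Cod C (g \<cdot> f) = Cod C g"
  using comp_in_hom[of f "Dom C f" "Cod C f" g "Cod C g"] assms by (auto simp: hom_def)

lemma assoc [simp]:
  assumes "f \<in> Ar C" "g \<in> Ar C" "h \<in> Ar C" "Dom C g = Cod C f" "Dom C h = Cod C g"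
  shows "(h \<cdot> g) \<cdot> f = h \<cdot> (g \<cdot> f)"
  using comp_assoc[of f "Dom C f" "Cod C f" g "Cod C g" h "Cod C h"] assms
  by (auto simp: hom_def)

lemma Id_arrow [simp]:
  assumes "A \<in> Ob C"
  shows "Id C A \<in> Ar C" "Dom C (Id C A) = A" "Cod C (Id C A) = A"
  using Id_in_hom[OF assms] by (auto simp: hom_def)

lemma Dom_Cod_Ob [simp]: "f \<in> Ar C \<Longrightarrow> Dom C f \<in> Ob C" "f \<in> Ar C \<Longrightarrow> Cod C f \<in> Ob C"
  by (auto intro: Dom_in_Ob Cod_in_Ob)

lemma Id_comp [simp]:
  "f \<in> Ar C \<Longrightarrow> Cod C f = B \<Longrightarrow> Id C B \<cdot> f = f"
  "f \<in> Ar C \<Longrightarrow> Dom C f = A \<Longrightarrow> f \<cdot> Id C A = f"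
  using comp_Id_left[of f "Dom C f" "Cod C f"] comp_Id_right[of f "Dom C f" "Cod C f"]
  by (auto simp: hom_def)

lemma comp_extend:
  assumes "a \<cdot> b = c" "a \<in> Ar C" "b \<in> Ar C" "Dom C a = Cod C b"
    and "x \<in> Ar C" "Dom C b = Cod C x"
  shows "a \<cdot> (b \<cdot> x) = c \<cdot> x"
  using assms by (metis assoc)

lemma monic_cancel:
  assumes "monic C m" "m \<cdot> f = m \<cdot> g" "f \<in> Ar C" "g \<in> Ar C"
    and "Dom C f = Dom C g" "Cod C f = Dom C m" "Cod C g = Dom C m"
  shows "f = g"
  using assms unfolding monic_def hom_def by blast

lemma monicI:
  assumes "m \<in> Ar C"
    and "\<And>f g. f \<in> Ar C \<Longrightarrow> g \<in> Ar C \<Longrightarrow> Dom C f = Dom C g \<Longrightarrow> Cod C f = Dom C m \<Longrightarrow>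
      Cod C g = Dom C m \<Longrightarrow> m \<cdot> f = m \<cdot> g \<Longrightarrow> f = g"
  shows "monic C m"
  using assms unfolding monic_def hom_def by auto

lemma monic_arrow: "monic C m \<Longrightarrow> m \<in> Ar C"
  by (simp add: monic_def)

lemma monic_comp:
  assumes "monic C m" "monic C n" "Dom C n = Cod C m"
  shows "monic C (n \<cdot> m)"
proof (rule monicI)
  note [simp] = monic_arrow[OF assms(1)] monic_arrow[OF assms(2)] assms(3)
  show "n \<cdot> m \<in> Ar C" by simp
  fix f g assume fg: "f \<in> Ar C" "g \<in> Ar C" "Dom C f = Dom C g" "Cod C f = Dom C (n \<cdot> m)"
    "Cod C g = Dom C (n \<cdot> m)" "(n \<cdot> m) \<cdot> f = (n \<cdot> m) \<cdot> g"
  have "m \<cdot> f = m \<cdot> g" by (rule monic_cancel[OF assms(2)]) (use fg in simp_all)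
  then show "f = g" by - (rule monic_cancel[OF assms(1)], use fg in simp_all)
qed

lemma monic_of_comp:
  assumes "monic C (n \<cdot> m)" "m \<in> Ar C" "n \<in> Ar C" "Dom C n = Cod C m"
  shows "monic C m"
proof (rule monicI)
  note [simp] = assms(2-4)
  fix f g assume fg: "f \<in> Ar C" "g \<in> Ar C" "Dom C f = Dom C g" "Cod C f = Dom C m"
    "Cod C g = Dom C m" "m \<cdot> f = m \<cdot> g"
  show "f = g"
    by (rule monic_cancel[OF assms(1)]) (use fg in simp_all)
qed (rule assms(2))

lemma monic_Id: "A \<in> Ob C \<Longrightarrow> monic C (Id C A)"
  by (rule monicI) auto

lemma isomorphism_inverse:
  assumes "isomorphism C f"
  obtains g where "g \<in> Ar C" "Dom C g = Cod C f" "Cod C g = Dom C f"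
    "g \<cdot> f = Id C (Dom C f)" "f \<cdot> g = Id C (Cod C f)"
  using assms unfolding isomorphism_def hom_def by blast

lemma isomorphismI:
  assumes "f \<in> Ar C" "g \<in> Ar C" "Dom C g = Cod C f" "Cod C g = Dom C f"
    "g \<cdot> f = Id C (Dom C f)" "f \<cdot> g = Id C (Cod C f)"
  shows "isomorphism C f"
  using assms unfolding isomorphism_def hom_def by blast

lemma isomorphism_arrow: "isomorphism C f \<Longrightarrow> f \<in> Ar C"
  by (simp add: isomorphism_def)

lemma isomorphism_Id: "A \<in> Ob C \<Longrightarrow> isomorphism C (Id C A)"
  by (rule isomorphismI[where g = "Id C A"]) auto

lemma isomorphism_monic:
  assumes "isomorphism C f"
  shows "monic C f"
proof -
  obtain g where g: "g \<in> Ar C" "Dom C g = Cod C f" "Cod C g = Dom C f"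
    "g \<cdot> f = Id C (Dom C f)" by (rule isomorphism_inverse[OF assms])
  show ?thesis
    by (rule monic_of_comp[where n = g])
      (use g isomorphism_arrow[OF assms] monic_Id in auto)
qed

lemma split_monic_isomorphism:
  assumes "monic C m" "d \<in> Ar C" "Dom C d = Cod C m" "Cod C d = Dom C m"
    and "m \<cdot> d = Id C (Cod C m)"
  shows "isomorphism C m"
proof (rule isomorphismI[where g = d])
  note [simp] = monic_arrow[OF assms(1)] assms(2-4)
  show "d \<cdot> m = Id C (Dom C m)"
    by (rule monic_cancel[OF assms(1)])
      (use comp_extend[OF assms(5), of m] in simp_all)
qed (use assms monic_arrow[OF assms(1)] in auto)

lemma coequalizerD:
  assumes "coequalizer C a b q"
  shows "a \<in> Ar C" "b \<in> Ar C" "q \<in> Ar C" "Dom C b = Dom C a" "Cod C b = Cod C a"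
    "Dom C q = Cod C a" "q \<cdot> a = q \<cdot> b"
  using assms unfolding coequalizer_def hom_def by auto

lemma coequalizer_factor:
  assumes "coequalizer C a b q" "h \<in> Ar C" "Dom C h = Cod C a" "h \<cdot> a = h \<cdot> b"
  shows "\<exists>!u. u \<in> hom C (Cod C q) (Cod C h) \<and> u \<cdot> q = h"
  using assms unfolding coequalizer_def by blast

lemma regular_epi_arrow: "regular_epi C q \<Longrightarrow> q \<in> Ar C"
  unfolding regular_epi_def by (auto dest: coequalizerD)

lemma regular_epi_cancel:
  assumes "regular_epi C q" "f \<cdot> q = g \<cdot> q" "f \<in> Ar C" "g \<in> Ar C"
    and "Dom C f = Cod C q" "Dom C g = Cod C q" "Cod C f = Cod C g"
  shows "f = g"
proof -
  obtain a b where co: "coequalizer C a b q" using assms(1) unfolding regular_epi_def by auto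
  note [simp] = coequalizerD(1-6)[OF co] assms(3-7)
  have "\<exists>!u. u \<in> hom C (Cod C q) (Cod C (f \<cdot> q)) \<and> u \<cdot> q = f \<cdot> q"
    by (rule coequalizer_factor[OF co]) (simp_all add: coequalizerD(7)[OF co])
  moreover have "f \<in> hom C (Cod C q) (Cod C (f \<cdot> q)) \<and> f \<cdot> q = f \<cdot> q"
    by (simp add: hom_def)
  moreover have "g \<in> hom C (Cod C q) (Cod C (f \<cdot> q)) \<and> g \<cdot> q = f \<cdot> q"
    by (simp add: hom_def assms(2))
  ultimately show ?thesis by blast
qed

text \<open>Regular epimorphisms are orthogonal to monomorphisms: \<open>q\<close> is the coequalizer of some pair,
  \<open>m \<cdot> g = h \<cdot> q\<close> identifies that pair, and because \<open>m\<close> is monic, so does \<open>g\<close>.\<close>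

lemma regular_epi_fill_in:
  assumes "regular_epi C q" "monic C m" "m \<cdot> g = h \<cdot> q"
    and "g \<in> Ar C" "h \<in> Ar C" "Dom C g = Dom C q" "Dom C m = Cod C g" "Dom C h = Cod C q"
  obtains u where "u \<in> Ar C" "Dom C u = Cod C q" "Cod C u = Cod C g" "u \<cdot> q = g"
proof -
  obtain a b where co: "coequalizer C a b q" using assms(1) unfolding regular_epi_def by auto
  note [simp] = coequalizerD(1-6)[OF co] assms(4-8) monic_arrow[OF assms(2)]
  have "(m \<cdot> g) \<cdot> a = (m \<cdot> g) \<cdot> b"
    unfolding assms(3) using coequalizerD(7)[OF co] by simp
  then have "g \<cdot> a = g \<cdot> b"
    by - (rule monic_cancel[OF assms(2)], simp_all)
  then have "\<exists>!u. u \<in> hom C (Cod C q) (Cod C g) \<and> u \<cdot> q = g"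
    by - (rule coequalizer_factor[OF co], simp_all)
  then show ?thesis using that unfolding hom_def by auto
qed

lemma regular_epi_through_monic:
  assumes "regular_epi C q" "monic C m" "q = m \<cdot> h" "h \<in> Ar C" "Dom C m = Cod C h"
  shows "isomorphism C m"
proof -
  note [simp] = assms(4-5) monic_arrow[OF assms(2)]
  have [simp]: "Dom C q = Dom C h" "Cod C q = Cod C m" unfolding assms(3) by simp_all
  have [simp]: "q \<in> Ar C" by (rule regular_epi_arrow[OF assms(1)])
  obtain u where u: "u \<in> Ar C" "Dom C u = Cod C q" "Cod C u = Cod C h" "u \<cdot> q = h"
    by (rule regular_epi_fill_in[OF assms(1,2), of h "Id C (Cod C q)"]) (simp_all add: assms(3))
  have "m \<cdot> u = Id C (Cod C m)"
    by (rule regular_epi_cancel[OF assms(1)]) (use u assms(3) in simp_all)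
  then show ?thesis
    by - (rule split_monic_isomorphism[OF assms(2), of u], use u in simp_all)
qed

lemma regular_epi_isomorphism_comp:
  assumes "regular_epi C e" "isomorphism C i" "Dom C i = Cod C e"
  shows "regular_epi C (i \<cdot> e)"
proof -
  obtain a b where co: "coequalizer C a b e" using assms(1) unfolding regular_epi_def by auto
  obtain j where j: "j \<in> Ar C" "Dom C j = Cod C i" "Cod C j = Dom C i"
    "j \<cdot> i = Id C (Dom C i)" "i \<cdot> j = Id C (Cod C i)" by (rule isomorphism_inverse[OF assms(2)])
  note [simp] = coequalizerD(1-6)[OF co] j(1-3) assms(3) isomorphism_arrow[OF assms(2)]
  have ji: "j \<cdot> (i \<cdot> x) = x" if "x \<in> Ar C" "Cod C x = Dom C i" for x
    using comp_extend[OF j(4), of x] that by simp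
  have "coequalizer C a b (i \<cdot> e)"
    unfolding coequalizer_def
  proof (intro conjI ballI impI)
    show "(i \<cdot> e) \<cdot> a = (i \<cdot> e) \<cdot> b" using coequalizerD(7)[OF co] by simp
    fix h assume h: "h \<in> Ar C" "Dom C h = Cod C a \<and> h \<cdot> a = h \<cdot> b"
    then have "\<exists>!u. u \<in> hom C (Cod C e) (Cod C h) \<and> u \<cdot> e = h"
      by - (rule coequalizer_factor[OF co], simp_all)
    then obtain u where u: "u \<in> Ar C" "Dom C u = Cod C e" "Cod C u = Cod C h" "u \<cdot> e = h"
      unfolding hom_def by auto
    show "\<exists>!u. u \<in> hom C (Cod C (i \<cdot> e)) (Cod C h) \<and> u \<cdot> (i \<cdot> e) = h"
    proof (rule ex1I[of _ "u \<cdot> j"])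
      show "u \<cdot> j \<in> hom C (Cod C (i \<cdot> e)) (Cod C h) \<and> (u \<cdot> j) \<cdot> (i \<cdot> e) = h"
        using u ji[of e] by (simp add: hom_def)
      fix w assume w: "w \<in> hom C (Cod C (i \<cdot> e)) (Cod C h) \<and> w \<cdot> (i \<cdot> e) = h"
      then have [simp]: "w \<in> Ar C" "Dom C w = Cod C i" "Cod C w = Cod C h"
        by (auto simp: hom_def)
      have "w \<cdot> i = u"
        by (rule regular_epi_cancel[OF assms(1)]) (use u w in simp_all)
      then have "(w \<cdot> i) \<cdot> j = u \<cdot> j" by simp
      then show "w = u \<cdot> j" using j(5) by simp
    qed
  qed (auto simp: hom_def)
  then show ?thesis unfolding regular_epi_def by auto
qed


section \<open>Zero arrows, kernels and cokernels\<close>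

lemma zero_object_hom:
  assumes "zero_object C Z" "f \<in> hom C A Z" "g \<in> hom C A Z"
  shows "f = g"
proof -
  have "A \<in> Ob C" using Dom_Cod_Ob(1)[of f] assms(2) unfolding hom_def by blast
  then have "\<exists>!h. h \<in> hom C A Z" using assms(1) by (simp add: zero_object_def)
  then show ?thesis using assms(2,3) by blast
qed

lemma zero_object_hom':
  assumes "zero_object C Z" "f \<in> hom C Z A" "g \<in> hom C Z A"
  shows "f = g"
proof -
  have "A \<in> Ob C" using Dom_Cod_Ob(2)[of f] assms(2) unfolding hom_def by blast
  then have "\<exists>!h. h \<in> hom C Z A" using assms(1) by (simp add: zero_object_def)
  then show ?thesis using assms(2,3) by blast
qed

lemma zero_object_arrows:
  assumes "zero_object C Z" "A \<in> Ob C"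
  obtains t i where "t \<in> hom C A Z" "i \<in> hom C Z A"
  using assms unfolding zero_object_def by blast

lemma zero_object_Ob: "zero_object C Z \<Longrightarrow> Z \<in> Ob C"
  by (simp add: zero_object_def)

lemma zero_arrowI:
  assumes "zero_object C Z" "a \<in> hom C A Z" "b \<in> hom C Z B"
  shows "zero_arrow C (b \<cdot> a)"
  using assms unfolding zero_arrow_def hom_def by auto

lemma zero_arrowE:
  assumes "zero_arrow C f"
  obtains A B Z a b where "zero_object C Z" "a \<in> hom C A Z" "b \<in> hom C Z B" "f = b \<cdot> a"
  using assms unfolding zero_arrow_def by blast

lemma zero_arrow_arrow: "zero_arrow C f \<Longrightarrow> f \<in> Ar C"
  by (simp add: zero_arrow_def)

lemma zero_arrow_comp_left:
  assumes "zero_arrow C f" "g \<in> Ar C" "Dom C g = Cod C f"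
  shows "zero_arrow C (g \<cdot> f)"
proof -
  obtain A B Z a b where z: "zero_object C Z" "a \<in> hom C A Z" "b \<in> hom C Z B"
    and f: "f = b \<cdot> a" by (rule zero_arrowE[OF assms(1)])
  have g: "g \<in> hom C B (Cod C g)" using assms(2,3) z f by (auto simp: hom_def)
  show ?thesis
    unfolding f comp_assoc[OF z(2,3) g, symmetric]
    by (rule zero_arrowI[OF z(1,2) comp_in_hom[OF z(3) g]])
qed

lemma zero_arrow_comp_right:
  assumes "zero_arrow C f" "g \<in> Ar C" "Cod C g = Dom C f"
  shows "zero_arrow C (f \<cdot> g)"
proof -
  obtain A B Z a b where z: "zero_object C Z" "a \<in> hom C A Z" "b \<in> hom C Z B"
    and f: "f = b \<cdot> a" by (rule zero_arrowE[OF assms(1)])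
  have g: "g \<in> hom C (Dom C g) A" using assms(2,3) z f by (auto simp: hom_def)
  show ?thesis
    unfolding f comp_assoc[OF g z(2,3)]
    by (rule zero_arrowI[OF z(1) comp_in_hom[OF g z(2)] z(3)])
qed

lemma zero_arrow_unique:
  assumes "zero_arrow C f" "zero_arrow C g" "Dom C f = Dom C g" "Cod C f = Cod C g"
  shows "f = g"
proof -
  obtain A B Z a b where z: "zero_object C Z" "a \<in> hom C A Z" "b \<in> hom C Z B"
    and f: "f = b \<cdot> a" by (rule zero_arrowE[OF assms(1)])
  obtain A' B' Z' a' b' where z': "zero_object C Z'" "a' \<in> hom C A' Z'" "b' \<in> hom C Z' B'"
    and g: "g = b' \<cdot> a'" by (rule zero_arrowE[OF assms(2)])
  have eq: "A' = A" "B' = B" using assms(3,4) z(2,3) z'(2,3) f g by (auto simp: hom_def)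
  obtain t where t: "t \<in> hom C Z Z'"
    using zero_object_arrows[OF z'(1) zero_object_Ob[OF z(1)]] by blast
  have "a' = t \<cdot> a"
    using zero_object_hom[OF z'(1,2)] comp_in_hom[OF z(2) t] eq by simp
  moreover have "b = b' \<cdot> t"
    using zero_object_hom'[OF z(1,3)] comp_in_hom[OF t z'(3)] eq by simp
  ultimately show ?thesis
    using f g comp_assoc[OF z(2) t z'(3)] by simp
qed

lemma zero_arrow_exists:
  assumes "pointed C" "A \<in> Ob C" "B \<in> Ob C"
  obtains z where "zero_arrow C z" "z \<in> Ar C" "Dom C z = A" "Cod C z = B"
proof -
  obtain Z where Z: "zero_object C Z" using assms(1) unfolding pointed_def by blast
  obtain t where t: "t \<in> hom C A Z" using zero_object_arrows[OF Z assms(2)] by blast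
  obtain i where i: "i \<in> hom C Z B" using zero_object_arrows[OF Z assms(3)] by blast
  show ?thesis
    by (rule that[of "i \<cdot> t"]) (use zero_arrowI[OF Z t i] t i in \<open>auto simp: hom_def\<close>)
qed

lemma monic_reflects_zero:
  assumes "pointed C" "monic C m" "f \<in> Ar C" "Dom C m = Cod C f" "zero_arrow C (m \<cdot> f)"
  shows "zero_arrow C f"
proof -
  note [simp] = monic_arrow[OF assms(2)] assms(3,4)
  have "Dom C f \<in> Ob C" "Cod C f \<in> Ob C" by simp_all
  from zero_arrow_exists[OF assms(1) this]
  obtain z where z: "zero_arrow C z" "z \<in> Ar C" "Dom C z = Dom C f" "Cod C z = Cod C f" .
  have "m \<cdot> f = m \<cdot> z"
    by (rule zero_arrow_unique[OF assms(5)])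
      (use z zero_arrow_comp_left[OF z(1), of m] in simp_all)
  then have "f = z" by - (rule monic_cancel[OF assms(2)], use z in simp_all)
  then show ?thesis using z by simp
qed

lemma is_kernelD:
  assumes "is_kernel C k f"
  shows "k \<in> Ar C" "f \<in> Ar C" "Cod C k = Dom C f" "zero_arrow C (f \<cdot> k)"
  using assms unfolding is_kernel_def by auto

lemma is_kernel_factor:
  assumes "is_kernel C k f" "h \<in> Ar C" "Cod C h = Dom C f" "zero_arrow C (f \<cdot> h)"
  obtains u where "u \<in> Ar C" "Dom C u = Dom C h" "Cod C u = Dom C k" "k \<cdot> u = h"
  using assms unfolding is_kernel_def hom_def by blast

lemma is_kernel_monic:
  assumes "is_kernel C k f"
  shows "monic C k"
proof (rule monicI)
  note [simp] = is_kernelD(1-3)[OF assms]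
  show "k \<in> Ar C" by simp
  fix a b assume ab: "a \<in> Ar C" "b \<in> Ar C" "Dom C a = Dom C b" "Cod C a = Dom C k"
    "Cod C b = Dom C k" "k \<cdot> a = k \<cdot> b"
  have "zero_arrow C ((f \<cdot> k) \<cdot> a)"
    by (rule zero_arrow_comp_right[OF is_kernelD(4)[OF assms]]) (use ab in simp_all)
  then have "zero_arrow C (f \<cdot> (k \<cdot> a))" using ab by simp
  moreover have "k \<cdot> a \<in> Ar C" "Cod C (k \<cdot> a) = Dom C f" using ab by simp_all
  ultimately have "\<exists>!u. u \<in> hom C (Dom C (k \<cdot> a)) (Dom C k) \<and> k \<cdot> u = k \<cdot> a"
    using assms unfolding is_kernel_def by blast
  moreover have "a \<in> hom C (Dom C (k \<cdot> a)) (Dom C k)" "b \<in> hom C (Dom C (k \<cdot> a)) (Dom C k)"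
    using ab by (simp_all add: hom_def)
  ultimately show "a = b" using ab(6) by metis
qed

lemma is_kernelI:
  assumes "monic C k" "f \<in> Ar C" "Cod C k = Dom C f" "zero_arrow C (f \<cdot> k)"
    and "\<And>h. h \<in> Ar C \<Longrightarrow> Cod C h = Dom C f \<Longrightarrow> zero_arrow C (f \<cdot> h) \<Longrightarrow>
      \<exists>u \<in> hom C (Dom C h) (Dom C k). k \<cdot> u = h"
  shows "is_kernel C k f"
  unfolding is_kernel_def
proof (intro conjI ballI impI)
  fix h assume "h \<in> Ar C" "Cod C h = Dom C f \<and> zero_arrow C (f \<cdot> h)"
  with assms(5) obtain u where u: "u \<in> hom C (Dom C h) (Dom C k)" "k \<cdot> u = h" by blast
  show "\<exists>!u. u \<in> hom C (Dom C h) (Dom C k) \<and> k \<cdot> u = h"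
    by (rule ex1I[of _ u]) (use u monic_cancel[OF assms(1)] in \<open>auto simp: hom_def\<close>)
qed (use assms monic_arrow in auto)

text \<open>Two reflections onto the same subcategory differ by a natural isomorphism. This lemma, its
  analogue for cokernels and their combination carry exactness of the image sequence across
  that isomorphism.\<close>

lemma is_kernel_isomorphic:
  assumes "is_kernel C k f" "isomorphism C a" "isomorphism C b" "isomorphism C c"
    and dom: "Dom C a = Dom C k" "Dom C b = Dom C f" "Dom C c = Cod C f"
    and k': "k' \<in> Ar C" "Dom C k' = Cod C a" "Cod C k' = Cod C b" "b \<cdot> k = k' \<cdot> a"
    and f': "f' \<in> Ar C" "Dom C f' = Cod C b" "Cod C f' = Cod C c" "c \<cdot> f = f' \<cdot> b"
  shows "is_kernel C k' f'"
proof -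
  obtain a' where a': "a' \<in> Ar C" "Dom C a' = Cod C a" "Cod C a' = Dom C a"
    "a' \<cdot> a = Id C (Dom C a)" "a \<cdot> a' = Id C (Cod C a)" by (rule isomorphism_inverse[OF assms(2)])
  obtain b' where b': "b' \<in> Ar C" "Dom C b' = Cod C b" "Cod C b' = Dom C b"
    "b' \<cdot> b = Id C (Dom C b)" "b \<cdot> b' = Id C (Cod C b)" by (rule isomorphism_inverse[OF assms(3)])
  obtain c' where c': "c' \<in> Ar C" "Dom C c' = Cod C c" "Cod C c' = Dom C c"
    "c' \<cdot> c = Id C (Dom C c)" by (rule isomorphism_inverse[OF assms(4)])
  note [simp] = is_kernelD(1-3)[OF assms(1)] a'(1-3) b'(1-3) c'(1-3) dom k'(1-3) f'(1-3)
    isomorphism_arrow[OF assms(2)] isomorphism_arrow[OF assms(3)] isomorphism_arrow[OF assms(4)]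
  have k'_eq: "k' = b \<cdot> (k \<cdot> a')"
    using comp_extend[OF k'(4), of a'] a'(5) by simp
  have f'_eq: "f' = c \<cdot> (f \<cdot> b')"
    using comp_extend[OF f'(4), of b'] b'(5) by simp
  have bb: "b \<cdot> (b' \<cdot> x) = x" if "x \<in> Ar C" "Cod C x = Cod C b" for x
    using comp_extend[OF b'(5), of x] that by simp
  have bb': "b' \<cdot> (b \<cdot> x) = x" if "x \<in> Ar C" "Cod C x = Dom C f" for x
    using comp_extend[OF b'(4), of x] that by simp
  have cc: "c' \<cdot> (c \<cdot> x) = x" if "x \<in> Ar C" "Cod C x = Cod C f" for x
    using comp_extend[OF c'(4), of x] that by simp
  have aa: "a' \<cdot> (a \<cdot> x) = x" if "x \<in> Ar C" "Cod C x = Dom C k" for x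
    using comp_extend[OF a'(4), of x] that by simp
  have "monic C a'"
    by (rule isomorphism_monic, rule isomorphismI[of a' a]) (use a' in simp_all)
  then have "monic C k'"
    unfolding k'_eq
    by (intro monic_comp isomorphism_monic[OF assms(3)] is_kernel_monic[OF assms(1)]) simp_all
  moreover have "zero_arrow C (f' \<cdot> k')"
  proof -
    have "f' \<cdot> k' = c \<cdot> ((f \<cdot> k) \<cdot> a')" unfolding f'_eq k'_eq by (simp add: bb')
    moreover have "zero_arrow C (c \<cdot> ((f \<cdot> k) \<cdot> a'))"
      using is_kernelD(4)[OF assms(1)]
      by - (rule zero_arrow_comp_left, rule zero_arrow_comp_right, simp_all)
    ultimately show ?thesis by simp
  qed
  moreover have "\<exists>u \<in> hom C (Dom C h) (Dom C k'). k' \<cdot> u = h"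
    if h: "h \<in> Ar C" "Cod C h = Dom C f'" "zero_arrow C (f' \<cdot> h)" for h
  proof -
    have "zero_arrow C (c' \<cdot> (f' \<cdot> h))"
      using h by - (rule zero_arrow_comp_left, simp_all)
    then have "zero_arrow C (f \<cdot> (b' \<cdot> h))" unfolding f'_eq using h by (simp add: cc)
    then obtain u where u: "u \<in> Ar C" "Dom C u = Dom C h" "Cod C u = Dom C k" "k \<cdot> u = b' \<cdot> h"
      using is_kernel_factor[OF assms(1), of "b' \<cdot> h"] h by (metis comp_arrow b'(1-3) dom(2) f'(2))
    have "k' \<cdot> (a \<cdot> u) = h" unfolding k'_eq using u h by (simp add: aa bb)
    then show ?thesis using u by (intro bexI[of _ "a \<cdot> u"]) (simp_all add: hom_def)
  qed
  ultimately show ?thesis by (intro is_kernelI) simp_all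
qed

lemma is_cokernelD:
  assumes "is_cokernel C f k"
  shows "f \<in> Ar C" "k \<in> Ar C" "Dom C f = Cod C k" "zero_arrow C (f \<cdot> k)"
  using assms unfolding is_cokernel_def by auto

lemma is_cokernel_factor:
  assumes "is_cokernel C f k" "h \<in> Ar C" "Dom C h = Cod C k" "zero_arrow C (h \<cdot> k)"
  shows "\<exists>!u. u \<in> hom C (Cod C f) (Cod C h) \<and> u \<cdot> f = h"
  using assms unfolding is_cokernel_def by blast

lemma is_cokernel_isomorphic:
  assumes "is_cokernel C f k" "isomorphism C a" "isomorphism C b" "isomorphism C c"
    and dom: "Dom C a = Dom C k" "Dom C b = Dom C f" "Dom C c = Cod C f"
    and k': "k' \<in> Ar C" "Dom C k' = Cod C a" "Cod C k' = Cod C b" "b \<cdot> k = k' \<cdot> a"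
    and f': "f' \<in> Ar C" "Dom C f' = Cod C b" "Cod C f' = Cod C c" "c \<cdot> f = f' \<cdot> b"
  shows "is_cokernel C f' k'"
proof -
  obtain a' where a': "a' \<in> Ar C" "Dom C a' = Cod C a" "Cod C a' = Dom C a"
    "a \<cdot> a' = Id C (Cod C a)" by (rule isomorphism_inverse[OF assms(2)])
  obtain b' where b': "b' \<in> Ar C" "Dom C b' = Cod C b" "Cod C b' = Dom C b"
    "b' \<cdot> b = Id C (Dom C b)" "b \<cdot> b' = Id C (Cod C b)" by (rule isomorphism_inverse[OF assms(3)])
  obtain c' where c': "c' \<in> Ar C" "Dom C c' = Cod C c" "Cod C c' = Dom C c"
    "c' \<cdot> c = Id C (Dom C c)" "c \<cdot> c' = Id C (Cod C c)" by (rule isomorphism_inverse[OF assms(4)])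
  note [simp] = is_cokernelD(1,2)[OF assms(1)] is_cokernelD(3)[OF assms(1), symmetric]
    a'(1-3) b'(1-3) c'(1-3) dom k'(1-3) f'(1-3)
    isomorphism_arrow[OF assms(2)] isomorphism_arrow[OF assms(3)] isomorphism_arrow[OF assms(4)]
  have k'_eq: "k' = b \<cdot> (k \<cdot> a')"
    using comp_extend[OF k'(4), of a'] a'(4) by simp
  have f'_eq: "f' = c \<cdot> (f \<cdot> b')"
    using comp_extend[OF f'(4), of b'] b'(5) by simp
  have bb': "b' \<cdot> (b \<cdot> x) = x" if "x \<in> Ar C" "Cod C x = Dom C f" for x
    using comp_extend[OF b'(4), of x] that by simp
  have cc: "c' \<cdot> (c \<cdot> x) = x" if "x \<in> Ar C" "Cod C x = Cod C f" for x
    using comp_extend[OF c'(4), of x] that by simp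
  show ?thesis
    unfolding is_cokernel_def
  proof (intro conjI ballI impI)
    have "f' \<cdot> k' = c \<cdot> ((f \<cdot> k) \<cdot> a')" unfolding f'_eq k'_eq by (simp add: bb')
    moreover have "zero_arrow C (c \<cdot> ((f \<cdot> k) \<cdot> a'))"
      using is_cokernelD(4)[OF assms(1)]
      by - (rule zero_arrow_comp_left, rule zero_arrow_comp_right, simp_all)
    ultimately show "zero_arrow C (f' \<cdot> k')" by simp
    fix h assume h: "h \<in> Ar C" "Dom C h = Cod C k' \<and> zero_arrow C (h \<cdot> k')"
    then have "zero_arrow C ((h \<cdot> k') \<cdot> a)"
      by - (rule zero_arrow_comp_right, simp_all)
    then have "zero_arrow C ((h \<cdot> b) \<cdot> k)" using h k'(4) by simp
    then have ex: "\<exists>!u. u \<in> hom C (Cod C f) (Cod C (h \<cdot> b)) \<and> u \<cdot> f = h \<cdot> b"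
      using h by - (rule is_cokernel_factor[OF assms(1)], simp_all)
    then obtain u where u: "u \<in> Ar C" "Dom C u = Cod C f" "Cod C u = Cod C h" "u \<cdot> f = h \<cdot> b"
      using h by (auto simp: hom_def)
    show "\<exists>!u. u \<in> hom C (Cod C f') (Cod C h) \<and> u \<cdot> f' = h"
    proof (rule ex1I[of _ "u \<cdot> c'"])
      have "u \<cdot> (c' \<cdot> f') = h \<cdot> (b \<cdot> b')"
        unfolding f'_eq using u h comp_extend[OF u(4), of b'] by (simp add: cc)
      then show "u \<cdot> c' \<in> hom C (Cod C f') (Cod C h) \<and> (u \<cdot> c') \<cdot> f' = h"
        using u h b'(5) by (simp add: hom_def)
      fix w assume w: "w \<in> hom C (Cod C f') (Cod C h) \<and> w \<cdot> f' = h"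
      then have [simp]: "w \<in> Ar C" "Dom C w = Cod C c" "Cod C w = Cod C h"
        by (auto simp: hom_def)
      have "(w \<cdot> c) \<cdot> f = h \<cdot> b"
        using f'(4) comp_extend[OF conjunct2[OF w], of b] by simp
      then have "w \<cdot> c \<in> hom C (Cod C f) (Cod C (h \<cdot> b)) \<and> (w \<cdot> c) \<cdot> f = h \<cdot> b"
        using h by (simp add: hom_def)
      moreover have "u \<in> hom C (Cod C f) (Cod C (h \<cdot> b)) \<and> u \<cdot> f = h \<cdot> b"
        using u h by (simp add: hom_def)
      ultimately have "w \<cdot> c = u" using ex by blast
      then have "(w \<cdot> c) \<cdot> c' = u \<cdot> c'" by simp
      then show "w = u \<cdot> c'" using c'(5) by simp
    qed
  qed simp_all
qed

lemma short_exact_isomorphic: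
  assumes "short_exact C k f" "isomorphism C a" "isomorphism C b" "isomorphism C c"
    and "Dom C a = Dom C k" "Dom C b = Dom C f" "Dom C c = Cod C f"
    and "k' \<in> Ar C" "Dom C k' = Cod C a" "Cod C k' = Cod C b" "b \<cdot> k = k' \<cdot> a"
    and "f' \<in> Ar C" "Dom C f' = Cod C b" "Cod C f' = Cod C c" "c \<cdot> f = f' \<cdot> b"
  shows "short_exact C k' f'"
  using assms is_kernel_isomorphic[OF _ assms(2-)] is_cokernel_isomorphic[OF _ assms(2-)]
  unfolding short_exact_def by blast

end

section \<open>Pullbacks and equalizers as finite limits\<close>

text \<open>For \<open>b = 1\<close> this is the free cospan \<open>0 \<rightarrow> 2 \<leftarrow> 1\<close>; for \<open>b = 0\<close> the two legs start at the
  same vertex and it is the free parallel pair. The identities are numbered like their objects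
  and the legs are 3 and 4, so one construction yields both pullbacks and equalizers.\<close>

definition cospan_shape :: "nat \<Rightarrow> (nat, nat) cat" where
  "cospan_shape b =
    \<lparr>Ob = {0, b, 2}, Ar = {0, b, 2, 3, 4},
     Dom = (\<lambda>a. if a = 3 then 0 else if a = 4 then b else a),
     Cod = (\<lambda>a. if a = 3 \<or> a = 4 then 2 else a),
     Id = (\<lambda>i. i), comp = (\<lambda>g f. if f \<le> 2 then g else f)\<rparr>"

definition cospan_diagram ::
  "('o, 'm) cat \<Rightarrow> 'o \<Rightarrow> 'o \<Rightarrow> 'o \<Rightarrow> 'm \<Rightarrow> 'm \<Rightarrow> (nat, nat, 'o, 'm) func" where
  "cospan_diagram C A B D f g =
    (let ob = \<lambda>i. if i = 0 then A else if i = 2 then D else B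
     in \<lparr>on_ob = ob, on_ar = (\<lambda>a. if a = 3 then f else if a = 4 then g else Id C (ob a))\<rparr>)"

lemma category_cospan_shape: "b < 2 \<Longrightarrow> category (cospan_shape b)"
  by unfold_locales (auto simp: cospan_shape_def hom_def split: if_splits)

context category
begin

lemma cospan_diagram_functor:
  fixes b :: nat
  assumes "b < 2" "f \<in> hom C A D" "g \<in> hom C B D" "b = 0 \<longrightarrow> A = B"
  shows "is_functor (cospan_shape b) C (cospan_diagram C A B D f g)"
proof -
  let ?J = "cospan_shape b" and ?D = "cospan_diagram C A B D f g"
  have b: "b = 0 \<and> A = B \<or> b = 1" using assms(1,4) by auto
  have ar [simp]: "f \<in> Ar C" "Dom C f = A" "Cod C f = D" "g \<in> Ar C" "Dom C g = B" "Cod C g = D"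
    using assms(2,3) by (auto simp: hom_def)
  have [simp]: "A \<in> Ob C" "B \<in> Ob C" "D \<in> Ob C"
    using Dom_Cod_Ob[OF ar(1)] Dom_Cod_Ob[OF ar(4)] by simp_all
  have ob: "on_ob ?D P \<in> Ob C" for P
    by (simp add: cospan_diagram_def)
  have idn: "on_ar ?D P = Id C (on_ob ?D P)" if "P \<in> Ob ?J" for P
    using that b unfolding cospan_shape_def cospan_diagram_def by auto
  have hom: "on_ar ?D a \<in> hom C (on_ob ?D P) (on_ob ?D Q)" if "a \<in> hom ?J P Q" for a P Q
  proof -
    have "a \<in> Ob ?J \<and> P = a \<and> Q = a \<or> a = 3 \<and> P = 0 \<and> Q = 2 \<or> a = 4 \<and> P = b \<and> Q = 2"
      using that b unfolding cospan_shape_def hom_def by auto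
    then show ?thesis
      using b idn[of a] Id_in_hom[OF ob[of a]] assms(2,3)
      by (elim disjE conjE) (simp_all add: cospan_diagram_def)
  qed
  show ?thesis
  proof (intro is_functor.intro is_functor_axioms.intro)
    show "category ?J" by (rule category_cospan_shape[OF assms(1)])
    show "category C" by unfold_locales
    fix a P Q c R assume a: "a \<in> hom ?J P Q" and c: "c \<in> hom ?J Q R"
    then have "a \<in> Ob ?J \<and> Q = a \<and> c \<cdot>\<^bsub>?J\<^esub> a = c \<or> c \<in> Ob ?J \<and> Q = c \<and> c \<cdot>\<^bsub>?J\<^esub> a = a"
      using b unfolding cospan_shape_def hom_def by auto
    then show "on_ar ?D (c \<cdot>\<^bsub>?J\<^esub> a) = on_ar ?D c \<cdot> on_ar ?D a"
      using idn[of Q] comp_Id_left[OF hom[OF a]] comp_Id_right[OF hom[OF c]] by auto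
  qed (use ob hom idn in \<open>auto simp: cospan_shape_def\<close>)
qed

lemma cospan_limit:
  fixes b :: nat
  assumes "finitely_complete C"
    and "b < 2" "f \<in> hom C A D" "g \<in> hom C B D" "b = 0 \<longrightarrow> A = B"
  obtains L p q where "p \<in> hom C L A" "q \<in> hom C L B" "f \<cdot> p = g \<cdot> q" "b = 0 \<Longrightarrow> p = q"
    "\<And>Z x y. x \<in> hom C Z A \<Longrightarrow> y \<in> hom C Z B \<Longrightarrow> f \<cdot> x = g \<cdot> y \<Longrightarrow>
      (b = 0 \<Longrightarrow> x = y) \<Longrightarrow> \<exists>!u. u \<in> hom C Z L \<and> p \<cdot> u = x \<and> q \<cdot> u = y"
proof -
  let ?J = "cospan_shape b" and ?D = "cospan_diagram C A B D f g"
  have b: "b = 0 \<and> A = B \<or> b = 1" using assms(2,5) by auto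
  have "finite (Ob ?J)" "finite (Ar ?J)" by (simp_all add: cospan_shape_def)
  then obtain L \<pi> where lim: "limit_cone ?J C ?D L \<pi>"
    using assms(1) cospan_diagram_functor[OF assms(2-)] unfolding finitely_complete_def by blast
  then have c: "cone ?J C ?D L \<pi>" by (simp add: limit_cone_def)
  have \<pi>0: "\<pi> 0 \<in> hom C L A" and \<pi>b: "\<pi> b \<in> hom C L B"
    using c b unfolding cone_def by (auto simp: cospan_shape_def cospan_diagram_def)
  have leg: "f \<cdot> \<pi> 0 = \<pi> 2" "g \<cdot> \<pi> b = \<pi> 2"
    using c b unfolding cone_def by (auto simp: cospan_shape_def cospan_diagram_def)
  show thesis
  proof (rule that[OF \<pi>0 \<pi>b])
    show "f \<cdot> \<pi> 0 = g \<cdot> \<pi> b" using leg by simp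
    show "\<pi> 0 = \<pi> b" if "b = 0" using that by simp
    fix Z x y assume xy: "x \<in> hom C Z A" "y \<in> hom C Z B" "f \<cdot> x = g \<cdot> y"
      "b = 0 \<Longrightarrow> x = y"
    define \<mu> where "\<mu> i = (if i = 0 then x else if i = 2 then f \<cdot> x else y)" for i :: nat
    have fx: "f \<cdot> x \<in> hom C Z D" by (rule comp_in_hom[OF xy(1) assms(3)])
    have \<mu>b: "\<mu> b = y" "\<mu> 0 = x" "\<mu> 2 = f \<cdot> x" using b xy(4) by (auto simp: \<mu>_def)
    have Z: "Z \<in> Ob C" using xy(1) Dom_Cod_Ob(1)[of x] unfolding hom_def by blast
    have "\<mu> i \<in> hom C Z (on_ob ?D i)" if "i \<in> Ob ?J" for i
    proof -
      have "i = 0 \<or> i = b \<or> i = 2" using that by (simp add: cospan_shape_def)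
      then show ?thesis using \<mu>b xy(1,2) fx b by (auto simp: cospan_diagram_def)
    qed
    moreover have "on_ar ?D a \<cdot> \<mu> (Dom ?J a) = \<mu> (Cod ?J a)" if "a \<in> Ar ?J" for a
    proof -
      have "a = 0 \<or> a = b \<or> a = 2 \<or> a = 3 \<or> a = 4" using that by (simp add: cospan_shape_def)
      then show ?thesis
        using b \<mu>b xy(3) comp_Id_left[OF xy(1)] comp_Id_left[OF xy(2)] comp_Id_left[OF fx]
        by (elim disjE) (auto simp: cospan_shape_def cospan_diagram_def)
    qed
    ultimately have "cone ?J C ?D Z \<mu>" using Z unfolding cone_def by blast
    then have ex: "\<exists>!u. u \<in> hom C Z L \<and> (\<forall>i \<in> Ob ?J. \<pi> i \<cdot> u = \<mu> i)"
      using lim unfolding limit_cone_def by blast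
    have "(\<forall>i \<in> Ob ?J. \<pi> i \<cdot> u = \<mu> i) \<longleftrightarrow> \<pi> 0 \<cdot> u = x \<and> \<pi> b \<cdot> u = y" if "u \<in> hom C Z L" for u
    proof -
      have "\<pi> 2 \<cdot> u = f \<cdot> (\<pi> 0 \<cdot> u)" using comp_assoc[OF that \<pi>0 assms(3)] leg(1) by simp
      then show ?thesis using \<mu>b unfolding cospan_shape_def by auto
    qed
    then show "\<exists>!u. u \<in> hom C Z L \<and> \<pi> 0 \<cdot> u = x \<and> \<pi> b \<cdot> u = y" using ex by metis
  qed
qed

lemma pullback_exists:
  assumes "finitely_complete C" "f \<in> Ar C" "g \<in> Ar C" "Cod C f = Cod C g"
  obtains p q where "pullback C f g p q"
proof -
  obtain L p q where L: "p \<in> hom C L (Dom C f)" "q \<in> hom C L (Dom C g)" "f \<cdot> p = g \<cdot> q"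
    and u: "\<And>Z x y. x \<in> hom C Z (Dom C f) \<Longrightarrow> y \<in> hom C Z (Dom C g) \<Longrightarrow> f \<cdot> x = g \<cdot> y \<Longrightarrow>
      \<exists>!u. u \<in> hom C Z L \<and> p \<cdot> u = x \<and> q \<cdot> u = y"
    by (rule cospan_limit[OF assms(1), of 1 f "Dom C f" "Cod C f" g "Dom C g"])
      (use assms arrow_in_hom[of f] arrow_in_hom[of g] in auto)
  have "Dom C p = L" "p \<in> Ar C" "Cod C p = Dom C f" using L(1) by (auto simp: hom_def)
  then have "pullback C f g p q" unfolding pullback_def using assms L u by auto
  then show thesis by (rule that)
qed

lemma equalizer_exists:
  assumes "finitely_complete C" "f \<in> Ar C" "g \<in> Ar C" "Dom C f = Dom C g" "Cod C f = Cod C g"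
  obtains e where "monic C e" "Cod C e = Dom C f" "f \<cdot> e = g \<cdot> e"
    "\<And>x. x \<in> Ar C \<Longrightarrow> Cod C x = Dom C f \<Longrightarrow> f \<cdot> x = g \<cdot> x \<Longrightarrow>
      \<exists>u \<in> hom C (Dom C x) (Dom C e). e \<cdot> u = x"
proof -
  obtain L p q where L: "p \<in> hom C L (Dom C f)" "f \<cdot> p = g \<cdot> q" "p = q"
    and u: "\<And>Z x y. x \<in> hom C Z (Dom C f) \<Longrightarrow> y \<in> hom C Z (Dom C g) \<Longrightarrow> f \<cdot> x = g \<cdot> y \<Longrightarrow>
      x = y \<Longrightarrow> \<exists>!u. u \<in> hom C Z L \<and> p \<cdot> u = x \<and> q \<cdot> u = y"
    by (rule cospan_limit[OF assms(1), of 0 f "Dom C f" "Cod C f" g "Dom C g"])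
      (use assms arrow_in_hom[of f] arrow_in_hom[of g] in auto)
  have p: "p \<in> Ar C" "Dom C p = L" "Cod C p = Dom C f" using L(1) by (auto simp: hom_def)
  have ex: "\<exists>!u. u \<in> hom C (Dom C x) L \<and> p \<cdot> u = x"
    if "x \<in> Ar C" "Cod C x = Dom C f" "f \<cdot> x = g \<cdot> x" for x
    using u[of x "Dom C x" x] that assms(4) L(3) by (simp add: hom_def)
  show thesis
  proof (rule that[of p])
    show "monic C p"
    proof (rule monicI)
      fix a c assume ac: "a \<in> Ar C" "c \<in> Ar C" "Dom C a = Dom C c" "Cod C a = Dom C p"
        "Cod C c = Dom C p" "p \<cdot> a = p \<cdot> c"
      have "f \<cdot> (p \<cdot> a) = g \<cdot> (p \<cdot> a)"
        using comp_extend[of f p "g \<cdot> p" a] L(2,3) p ac assms by simp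
      then have "\<exists>!u. u \<in> hom C (Dom C (p \<cdot> a)) L \<and> p \<cdot> u = p \<cdot> a"
        using ac p by (intro ex) simp_all
      moreover have "a \<in> hom C (Dom C (p \<cdot> a)) L" "c \<in> hom C (Dom C (p \<cdot> a)) L"
        using ac p by (simp_all add: hom_def)
      ultimately show "a = c" using ac(6) by metis
    qed (rule p)
    show "\<exists>u \<in> hom C (Dom C x) (Dom C p). p \<cdot> u = x"
      if "x \<in> Ar C" "Cod C x = Dom C f" "f \<cdot> x = g \<cdot> x" for x
      using ex[OF that] p(2) by blast
  qed (use p L in auto)
qed

lemma pullbackD:
  assumes "pullback C f g p q"
  shows "f \<in> Ar C" "g \<in> Ar C" "p \<in> Ar C" "q \<in> Ar C" "Cod C g = Cod C f"
    "Cod C p = Dom C f" "Cod C q = Dom C g" "Dom C q = Dom C p" "f \<cdot> p = g \<cdot> q"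
  using assms unfolding pullback_def hom_def by auto

lemma pullback_factor:
  assumes "pullback C f g p q" "x \<in> Ar C" "y \<in> Ar C" "Dom C y = Dom C x"
    "Cod C x = Dom C f" "Cod C y = Dom C g" "f \<cdot> x = g \<cdot> y"
  shows "\<exists>!u. u \<in> hom C (Dom C x) (Dom C p) \<and> p \<cdot> u = x \<and> q \<cdot> u = y"
  using assms unfolding pullback_def hom_def by simp

lemma pullback_lift:
  assumes "pullback C f g p q" "x \<in> Ar C" "y \<in> Ar C" "Dom C y = Dom C x"
    "Cod C x = Dom C f" "Cod C y = Dom C g" "f \<cdot> x = g \<cdot> y"
  obtains u where "u \<in> Ar C" "Dom C u = Dom C x" "Cod C u = Dom C p" "p \<cdot> u = x" "q \<cdot> u = y"
  using pullback_factor[OF assms] unfolding hom_def by blast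

lemma pullback_monic:
  assumes "pullback C f g p q" "monic C f"
  shows "monic C q"
proof (rule monicI)
  note [simp] = pullbackD(1-8)[OF assms(1)]
  show "q \<in> Ar C" by simp
  fix a b assume ab: "a \<in> Ar C" "b \<in> Ar C" "Dom C a = Dom C b" "Cod C a = Dom C q"
    "Cod C b = Dom C q" "q \<cdot> a = q \<cdot> b"
  have sq: "f \<cdot> (p \<cdot> x) = g \<cdot> (q \<cdot> x)" if "x \<in> Ar C" "Cod C x = Dom C p" for x
    using comp_extend[OF pullbackD(9)[OF assms(1)], of x] that by simp
  have "p \<cdot> a = p \<cdot> b"
    by (rule monic_cancel[OF assms(2)]) (use ab sq in simp_all)
  moreover have "\<exists>!u. u \<in> hom C (Dom C (p \<cdot> a)) (Dom C p) \<and> p \<cdot> u = p \<cdot> a \<and> q \<cdot> u = q \<cdot> a"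
    by (rule pullback_factor[OF assms(1)]) (use ab sq in simp_all)
  moreover have "a \<in> hom C (Dom C (p \<cdot> a)) (Dom C p)" "b \<in> hom C (Dom C (p \<cdot> a)) (Dom C p)"
    using ab by (simp_all add: hom_def)
  ultimately show "a = b" using ab(6) by metis
qed

lemma kernel_exists:
  assumes "finitely_complete C" "pointed C" "f \<in> Ar C"
  obtains k where "is_kernel C k f"
proof -
  obtain Z where Z: "zero_object C Z" using assms(2) unfolding pointed_def by blast
  have "Cod C f \<in> Ob C" using assms(3) by simp
  from zero_object_arrows[OF Z this] obtain i where "i \<in> hom C Z (Cod C f)" by blast
  then have i: "i \<in> Ar C" "Dom C i = Z" "Cod C i = Cod C f" by (auto simp: hom_def)
  have "monic C i"
    by (rule monicI) (use i zero_object_hom[OF Z] in \<open>auto simp: hom_def\<close>)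
  obtain p k where pb: "pullback C i f p k"
    by (rule pullback_exists[OF assms(1) i(1) assms(3) i(3)])
  note pbD = pullbackD[OF pb]
  have zero: "zero_arrow C (i \<cdot> x)" if "x \<in> Ar C" "Cod C x = Z" for x
    using zero_arrowI[OF Z, of x "Dom C x" i "Cod C f"] that i by (simp add: hom_def)
  have "is_kernel C k f"
  proof (rule is_kernelI)
    show "monic C k" by (rule pullback_monic[OF pb \<open>monic C i\<close>])
    show "zero_arrow C (f \<cdot> k)" using zero[of p] pbD i by simp
    fix h assume h: "h \<in> Ar C" "Cod C h = Dom C f" "zero_arrow C (f \<cdot> h)"
    have "Dom C h \<in> Ob C" using h(1) by simp
    from zero_object_arrows[OF Z this] obtain x where "x \<in> hom C (Dom C h) Z" by blast
    then have x: "x \<in> Ar C" "Dom C x = Dom C h" "Cod C x = Z" by (auto simp: hom_def)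
    have "i \<cdot> x = f \<cdot> h"
      by (rule zero_arrow_unique[OF zero h(3)]) (use x i h assms(3) in simp_all)
    with x i h obtain u where "u \<in> Ar C" "Dom C u = Dom C h" "Cod C u = Dom C p" "k \<cdot> u = h"
      using pullback_lift[OF pb, of x h] by metis
    then show "\<exists>u \<in> hom C (Dom C h) (Dom C k). k \<cdot> u = h"
      using pbD by (auto simp: hom_def)
  qed (use pbD in auto)
  then show thesis by (rule that)
qed

end

section \<open>Full subcategories\<close>

lemma full_subcategory_simps [simp]:
  "Ob (full_subcategory C S) = S"
  "Ar (full_subcategory C S) = {f \<in> Ar C. Dom C f \<in> S \<and> Cod C f \<in> S}"
  "Dom (full_subcategory C S) = Dom C" "Cod (full_subcategory C S) = Cod C"
  "Id (full_subcategory C S) = Id C" "comp (full_subcategory C S) = comp C"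
  by (simp_all add: full_subcategory_def)

lemma hom_full_subcategory:
  "A \<in> S \<Longrightarrow> B \<in> S \<Longrightarrow> hom (full_subcategory C S) A B = hom C A B"
  by (auto simp: hom_def)

lemma hom_full_subcategory_iff:
  "f \<in> hom (full_subcategory C S) A B \<longleftrightarrow> f \<in> hom C A B \<and> A \<in> S \<and> B \<in> S"
  by (auto simp: hom_def)

lemma full_subcategory_full_subcategory:
  assumes "X \<subseteq> Y"
  shows "full_subcategory (full_subcategory C Y) X = full_subcategory C X"
proof -
  have "Ar (full_subcategory (full_subcategory C Y) X) = Ar (full_subcategory C X)"
    using assms by auto
  then show ?thesis by (simp add: full_subcategory_def)
qed

context category
begin

lemma category_full_subcategory:
  assumes "S \<subseteq> Ob C"
  shows "category (full_subcategory C S)"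
  by unfold_locales
    (use assms Id_in_hom comp_in_hom comp_Id_left comp_Id_right comp_assoc
      in \<open>auto simp: hom_full_subcategory_iff\<close>)

lemma isomorphism_full_subcategory:
  "isomorphism (full_subcategory C S) f \<longleftrightarrow> isomorphism C f \<and> Dom C f \<in> S \<and> Cod C f \<in> S"
  unfolding isomorphism_def by (auto simp: hom_full_subcategory)

lemma monic_full_subcategory:
  assumes "monic C m" "Dom C m \<in> S" "Cod C m \<in> S"
  shows "monic (full_subcategory C S) m"
  using assms unfolding monic_def by (auto simp: hom_full_subcategory_iff)

lemma replete_full_subcategory:
  assumes "replete C X"
  shows "replete (full_subcategory C Y) X"
  using assms unfolding replete_def isomorphism_full_subcategory by simp

lemma zero_object_full_subcategory:
  assumes "zero_object C Z" "Z \<in> S" "S \<subseteq> Ob C"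
  shows "zero_object (full_subcategory C S) Z"
proof -
  have "hom (full_subcategory C S) A Z = hom C A Z \<and> hom (full_subcategory C S) Z A = hom C Z A \<and>
      A \<in> Ob C" if "A \<in> S" for A
    using that assms(2,3) by (auto simp: hom_full_subcategory)
  then show ?thesis using assms unfolding zero_object_def by auto
qed

text \<open>A zero arrow of the subcategory factors through some zero object of the subcategory, and
  the arrows into that object are unique, so they are zero arrows of \<open>C\<close> as well.\<close>

lemma zero_arrow_full_subcategory:
  assumes Z: "zero_object C Z" "Z \<in> S" "S \<subseteq> Ob C"
  shows "zero_arrow (full_subcategory C S) f \<longleftrightarrow>
    zero_arrow C f \<and> Dom C f \<in> S \<and> Cod C f \<in> S"
proof
  interpret S: category "full_subcategory C S" by (rule category_full_subcategory[OF Z(3)])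
  assume f: "zero_arrow (full_subcategory C S) f"
  then obtain A B W a b where W: "zero_object (full_subcategory C S) W"
    and "a \<in> hom (full_subcategory C S) A W" "b \<in> hom (full_subcategory C S) W B"
    and "f = b \<cdot>\<^bsub>full_subcategory C S\<^esub> a" by (rule S.zero_arrowE)
  then have f_eq: "f = b \<cdot> a" and a: "a \<in> hom C A W" and b: "b \<in> hom C W B"
    and S: "A \<in> S" "W \<in> S" "B \<in> S"
    by (auto simp: hom_full_subcategory_iff)
  obtain t where t: "t \<in> hom C A Z" using zero_object_arrows[OF Z(1), of A] S Z(3) by blast
  obtain i where i: "i \<in> hom C Z W" using zero_object_arrows[OF Z(1), of W] S Z(3) by blast
  have "i \<cdot> t \<in> hom C A W" by (rule comp_in_hom[OF t i])
  then have "a = i \<cdot> t"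
    using S.zero_object_hom[OF W, of a A "i \<cdot> t"] a S by (simp add: hom_full_subcategory)
  then have "zero_arrow C a" using zero_arrowI[OF Z(1) t i] by simp
  then have "zero_arrow C f"
    unfolding f_eq by (rule zero_arrow_comp_left) (use a b in \<open>auto simp: hom_def\<close>)
  moreover have "Dom C f \<in> S \<and> Cod C f \<in> S" using S.zero_arrow_arrow[OF f] by simp
  ultimately show "zero_arrow C f \<and> Dom C f \<in> S \<and> Cod C f \<in> S" by simp
next
  interpret S: category "full_subcategory C S" by (rule category_full_subcategory[OF Z(3)])
  assume f: "zero_arrow C f \<and> Dom C f \<in> S \<and> Cod C f \<in> S"
  obtain t where t: "t \<in> hom C (Dom C f) Z"
    using zero_object_arrows[OF Z(1), of "Dom C f"] f Z(3) by blast
  obtain i where i: "i \<in> hom C Z (Cod C f)"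
    using zero_object_arrows[OF Z(1), of "Cod C f"] f Z(3) by blast
  have "f = i \<cdot> t"
    by (rule zero_arrow_unique[OF conjunct1[OF f] zero_arrowI[OF Z(1) t i]])
      (use t i in \<open>auto simp: hom_def\<close>)
  then show "zero_arrow (full_subcategory C S) f"
    using S.zero_arrowI[OF zero_object_full_subcategory[OF Z], of t "Dom C f" i "Cod C f"]
      t i f Z(2) by (simp add: hom_full_subcategory)
qed

lemma is_kernel_full_subcategory:
  assumes Z: "zero_object C Z" "Z \<in> S" "S \<subseteq> Ob C"
    and "is_kernel C k f" "Dom C k \<in> S" "Dom C f \<in> S" "Cod C f \<in> S"
  shows "is_kernel (full_subcategory C S) k f"
  using assms(4-7) is_kernelD[OF assms(4)] unfolding is_kernel_def
  by (simp add: zero_arrow_full_subcategory[OF Z] hom_full_subcategory)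

lemma is_cokernel_full_subcategory:
  assumes Z: "zero_object C Z" "Z \<in> S" "S \<subseteq> Ob C"
    and "is_cokernel C f k" "Dom C k \<in> S" "Cod C k \<in> S" "Cod C f \<in> S"
  shows "is_cokernel (full_subcategory C S) f k"
  using assms(4-7) is_cokernelD[OF assms(4)] unfolding is_cokernel_def
  by (simp add: zero_arrow_full_subcategory[OF Z] hom_full_subcategory)

end

section \<open>Reflections as universal arrows\<close>

definition universal_arrow :: "('o, 'm) cat \<Rightarrow> 'o set \<Rightarrow> 'm \<Rightarrow> bool" where
  "universal_arrow C S e \<longleftrightarrow> e \<in> Ar C \<and> Cod C e \<in> S \<and>
    (\<forall>g \<in> Ar C. Dom C g = Dom C e \<and> Cod C g \<in> S \<longrightarrow>
      (\<exists>!u. u \<in> hom C (Cod C e) (Cod C g) \<and> u \<cdot>\<^bsub>C\<^esub> e = g))"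

context category
begin

lemma universal_arrowD:
  "universal_arrow C S e \<Longrightarrow> e \<in> Ar C" "universal_arrow C S e \<Longrightarrow> Cod C e \<in> S"
  by (auto simp: universal_arrow_def)

lemma universal_arrow_factor:
  assumes "universal_arrow C S e" "g \<in> Ar C" "Dom C g = Dom C e" "Cod C g \<in> S"
  obtains u where "u \<in> Ar C" "Dom C u = Cod C e" "Cod C u = Cod C g" "u \<cdot> e = g"
  using assms unfolding universal_arrow_def hom_def by blast

lemma universal_arrow_cancel:
  assumes "universal_arrow C S e" "u \<cdot> e = v \<cdot> e" "u \<in> Ar C" "v \<in> Ar C"
    and "Dom C u = Cod C e" "Dom C v = Cod C e" "Cod C u = Cod C v" "Cod C v \<in> S"
  shows "u = v"
proof -
  note [simp] = universal_arrowD(1)[OF assms(1)] assms(3-8)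
  have "v \<cdot> e \<in> Ar C \<and> Dom C (v \<cdot> e) = Dom C e \<and> Cod C (v \<cdot> e) \<in> S" by simp
  then have "\<exists>!w. w \<in> hom C (Cod C e) (Cod C (v \<cdot> e)) \<and> w \<cdot> e = v \<cdot> e"
    using assms(1) unfolding universal_arrow_def by blast
  moreover have "u \<in> hom C (Cod C e) (Cod C (v \<cdot> e)) \<and> u \<cdot> e = v \<cdot> e"
    using assms(2) by (simp add: hom_def)
  moreover have "v \<in> hom C (Cod C e) (Cod C (v \<cdot> e)) \<and> v \<cdot> e = v \<cdot> e"
    by (simp add: hom_def)
  ultimately show ?thesis by blast
qed

lemma universal_arrowI:
  assumes "e \<in> Ar C" "Cod C e \<in> S"
    and "\<And>g. g \<in> Ar C \<Longrightarrow> Dom C g = Dom C e \<Longrightarrow> Cod C g \<in> S \<Longrightarrow>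
      \<exists>u \<in> hom C (Cod C e) (Cod C g). u \<cdot> e = g"
    and "\<And>u v. u \<in> Ar C \<Longrightarrow> v \<in> Ar C \<Longrightarrow> Dom C u = Cod C e \<Longrightarrow> Dom C v = Cod C e \<Longrightarrow>
      Cod C u = Cod C v \<Longrightarrow> Cod C v \<in> S \<Longrightarrow> u \<cdot> e = v \<cdot> e \<Longrightarrow> u = v"
  shows "universal_arrow C S e"
  unfolding universal_arrow_def
proof (intro conjI ballI impI)
  fix g assume g: "g \<in> Ar C" "Dom C g = Dom C e \<and> Cod C g \<in> S"
  then obtain u where u: "u \<in> hom C (Cod C e) (Cod C g)" "u \<cdot> e = g" using assms(3) by blast
  show "\<exists>!u. u \<in> hom C (Cod C e) (Cod C g) \<and> u \<cdot> e = g"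
  proof (rule ex1I[of _ u])
    fix v assume v: "v \<in> hom C (Cod C e) (Cod C g) \<and> v \<cdot> e = g"
    show "v = u"
      by (rule assms(4)) (use u v g in \<open>auto simp: hom_def\<close>)
  qed (use u in simp)
qed (use assms in auto)

lemma reflection_subset: "reflection C S F \<eta> \<Longrightarrow> S \<subseteq> Ob C"
  and reflection_replete: "reflection C S F \<eta> \<Longrightarrow> replete C S"
  by (simp_all add: reflection_def)

lemma reflection_on_ob:
  assumes "reflection C S F \<eta>" "A \<in> Ob C"
  shows "on_ob F A \<in> S"
proof -
  interpret adjunction C "full_subcategory C S" F id_func \<eta>
    using assms(1) by (simp add: reflection_def)
  show ?thesis using F.on_ob_in_Ob[OF assms(2)] by simp
qed

lemma reflection_unit:
  assumes "reflection C S F \<eta>" "A \<in> Ob C"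
  shows "\<eta> A \<in> Ar C" "Dom C (\<eta> A) = A" "Cod C (\<eta> A) = on_ob F A"
    "universal_arrow C S (\<eta> A)"
proof -
  interpret adjunction C "full_subcategory C S" F id_func \<eta>
    using assms(1) by (simp add: reflection_def)
  have S: "on_ob F A \<in> S" by (rule reflection_on_ob[OF assms])
  show \<eta>: "\<eta> A \<in> Ar C" "Dom C (\<eta> A) = A" "Cod C (\<eta> A) = on_ob F A"
    using unit.component_in_hom[OF assms(2)] by (auto simp: hom_def id_func_def comp_func_def)
  show "universal_arrow C S (\<eta> A)"
    unfolding universal_arrow_def
  proof (intro conjI ballI impI)
    fix g assume g: "g \<in> Ar C" "Dom C g = Dom C (\<eta> A) \<and> Cod C g \<in> S"
    then have "g \<in> hom C A (on_ob id_func (Cod C g))"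
      using \<eta> by (auto simp: hom_def id_func_def)
    from unit_universal[OF assms(2) _ this] g S
    show "\<exists>!u. u \<in> hom C (Cod C (\<eta> A)) (Cod C g) \<and> u \<cdot> \<eta> A = g"
      by (simp add: hom_full_subcategory \<eta> id_func_def)
  qed (use \<eta> S in auto)
qed

lemma reflection_on_ar:
  assumes "reflection C S F \<eta>" "f \<in> Ar C"
  shows "on_ar F f \<in> Ar C" "Dom C (on_ar F f) = on_ob F (Dom C f)"
    "Cod C (on_ar F f) = on_ob F (Cod C f)"
    "on_ar F f \<cdot> \<eta> (Dom C f) = \<eta> (Cod C f) \<cdot> f"
proof -
  interpret adjunction C "full_subcategory C S" F id_func \<eta>
    using assms(1) by (simp add: reflection_def)
  note f = arrow_in_hom[OF assms(2)]
  show "on_ar F f \<in> Ar C" "Dom C (on_ar F f) = on_ob F (Dom C f)"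
    "Cod C (on_ar F f) = on_ob F (Cod C f)"
    using F.on_ar_in_hom[OF f] by (auto simp: hom_full_subcategory_iff hom_def)
  show "on_ar F f \<cdot> \<eta> (Dom C f) = \<eta> (Cod C f) \<cdot> f"
    using unit.naturality[OF f] by (simp add: id_func_def comp_func_def)
qed

lemma reflection_functor:
  "reflection C S F \<eta> \<Longrightarrow> is_functor C (full_subcategory C S) F"
  by (simp add: reflection_def adjunction_def)

text \<open>Functoriality comes for free: both sides of each functor law agree after composition with
  a universal arrow.\<close>

lemma reflectionI:
  assumes S: "S \<subseteq> Ob C" "replete C S"
    and ob: "\<And>A. A \<in> Ob C \<Longrightarrow> Dom C (\<eta> A) = A \<and> Cod C (\<eta> A) = on_ob F A \<and>
      universal_arrow C S (\<eta> A)"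
    and ar: "\<And>f. f \<in> Ar C \<Longrightarrow> on_ar F f \<in> hom C (on_ob F (Dom C f)) (on_ob F (Cod C f)) \<and>
      on_ar F f \<cdot> \<eta> (Dom C f) = \<eta> (Cod C f) \<cdot> f"
  shows "reflection C S F \<eta>"
proof -
  interpret S: category "full_subcategory C S" by (rule category_full_subcategory[OF S(1)])
  have \<eta>: "\<eta> A \<in> Ar C" "Dom C (\<eta> A) = A" "Cod C (\<eta> A) = on_ob F A" "on_ob F A \<in> S"
    if "A \<in> Ob C" for A
    using ob[OF that] universal_arrowD[of S "\<eta> A"] by auto
  have F: "on_ar F f \<in> Ar C" "Dom C (on_ar F f) = on_ob F (Dom C f)"
    "Cod C (on_ar F f) = on_ob F (Cod C f)" "on_ar F f \<cdot> \<eta> (Dom C f) = \<eta> (Cod C f) \<cdot> f"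
    if "f \<in> Ar C" for f
    using ar[OF that] by (auto simp: hom_def)
  have Id: "on_ar F (Id C A) = Id C (on_ob F A)" if A: "A \<in> Ob C" for A
  proof -
    have [simp]: "on_ob F A \<in> Ob C" using \<eta>(4)[OF A] S(1) by blast
    show ?thesis
      by (rule universal_arrow_cancel[of S "\<eta> A"])
        (use ob[OF A] \<eta>[OF A] F[of "Id C A"] A in auto)
  qed
  have comp: "on_ar F (g \<cdot> f) = on_ar F g \<cdot> on_ar F f"
    if fg: "f \<in> Ar C" "g \<in> Ar C" "Dom C g = Cod C f" for f g
  proof (rule universal_arrow_cancel[of S "\<eta> (Dom C f)"])
    note [simp] = fg F(1-3)[OF fg(1)] F(1-3)[OF fg(2)] F(1-3)[of "g \<cdot> f"]
      \<eta>(1-3)[of "Dom C f"] \<eta>(1-3)[of "Cod C f"] \<eta>(1-3)[of "Cod C g"]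
    have "(on_ar F g \<cdot> on_ar F f) \<cdot> \<eta> (Dom C f) = (on_ar F g \<cdot> \<eta> (Dom C g)) \<cdot> f"
      using F(4)[OF fg(1)] by simp
    also have "\<dots> = \<eta> (Cod C g) \<cdot> (g \<cdot> f)"
      unfolding F(4)[OF fg(2)] by simp
    also have "\<dots> = on_ar F (g \<cdot> f) \<cdot> \<eta> (Dom C f)"
      using F(4)[of "g \<cdot> f"] by simp
    finally show "on_ar F (g \<cdot> f) \<cdot> \<eta> (Dom C f) = (on_ar F g \<cdot> on_ar F f) \<cdot> \<eta> (Dom C f)" ..
  qed (use fg ob \<eta>(4) F(1-3) \<eta>(1-3) in auto)
  have functor_F: "is_functor C (full_subcategory C S) F"
  proof (intro is_functor.intro is_functor_axioms.intro)
    show "category C" "category (full_subcategory C S)" by unfold_locales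
    fix f A B assume f: "f \<in> hom C A B"
    then show "on_ar F f \<in> hom (full_subcategory C S) (on_ob F A) (on_ob F B)"
      using ar[of f] \<eta>(4) Dom_Cod_Ob[of f] by (auto simp: hom_full_subcategory_iff hom_def)
    fix g E assume "g \<in> hom C B E"
    with f show "on_ar F (g \<cdot> f) = on_ar F g \<cdot>\<^bsub>full_subcategory C S\<^esub> on_ar F f"
      using comp[of f g] by (simp add: hom_def)
  qed (use \<eta> Id in auto)
  have inclusion: "is_functor (full_subcategory C S) C id_func"
  proof (intro is_functor.intro is_functor_axioms.intro)
    show "category C" "category (full_subcategory C S)" by unfold_locales
  qed (use S in \<open>auto simp: id_func_def hom_full_subcategory_iff\<close>)
  have id: "is_functor C C id_func"
  proof (intro is_functor.intro is_functor_axioms.intro)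
    show "category C" "category C" by unfold_locales
  qed (auto simp: id_func_def)
  have CC: "is_functor C C (comp_func id_func F)"
  proof (intro is_functor.intro is_functor_axioms.intro)
    interpret F: is_functor C "full_subcategory C S" F by (rule functor_F)
    show "category C" "category C" by unfold_locales
    show "on_ob (comp_func id_func F) A \<in> Ob C" if "A \<in> Ob C" for A
      using \<eta>(4)[OF that] S(1) by (auto simp: id_func_def comp_func_def)
    show "on_ar (comp_func id_func F) f \<in>
      hom C (on_ob (comp_func id_func F) A) (on_ob (comp_func id_func F) B)"
      if "f \<in> hom C A B" for f A B
      using F.on_ar_in_hom[OF that] by (simp add: id_func_def comp_func_def hom_full_subcategory_iff)
    show "on_ar (comp_func id_func F) (g \<cdot> f) =
      on_ar (comp_func id_func F) g \<cdot> on_ar (comp_func id_func F) f"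
      if "f \<in> hom C A B" "g \<in> hom C B E" for f g A B E
      using F.on_ar_comp[OF that] by (simp add: id_func_def comp_func_def)
  qed (simp add: Id id_func_def comp_func_def)
  have nat: "natural_transformation C C id_func (comp_func id_func F) \<eta>"
  proof (intro natural_transformation.intro natural_transformation_axioms.intro)
    show "\<eta> A \<in> hom C (on_ob id_func A) (on_ob (comp_func id_func F) A)" if "A \<in> Ob C" for A
      using \<eta>[OF that] by (simp add: hom_def id_func_def comp_func_def)
    show "\<eta> B \<cdot> on_ar id_func f = on_ar (comp_func id_func F) f \<cdot> \<eta> A"
      if "f \<in> hom C A B" for f A B
      using F(4)[of f] that by (auto simp: hom_def id_func_def comp_func_def)
  qed (rule id CC)+
  have "\<exists>!g. g \<in> hom (full_subcategory C S) (on_ob F A) B \<and> on_ar id_func g \<cdot> \<eta> A = f"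
    if A: "A \<in> Ob C" and B: "B \<in> S" and f: "f \<in> hom C A B" for A B f
  proof -
    have f: "f \<in> Ar C" "Dom C f = A" "Cod C f = B" using f by (auto simp: hom_def)
    have "f \<in> Ar C \<and> Dom C f = Dom C (\<eta> A) \<and> Cod C f \<in> S" using f B \<eta>(2)[OF A] by simp
    then have "\<exists>!u. u \<in> hom C (Cod C (\<eta> A)) (Cod C f) \<and> u \<cdot> \<eta> A = f"
      using ob[OF A] unfolding universal_arrow_def by blast
    then have "\<exists>!u. u \<in> hom C (on_ob F A) B \<and> u \<cdot> \<eta> A = f"
      by (simp only: \<eta>(3)[OF A] f(3))
    then show ?thesis
      by (simp add: hom_full_subcategory[OF \<eta>(4)[OF A] B] id_func_def)
  qed
  then have "adjunction_axioms C (full_subcategory C S) F id_func \<eta>"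
    by unfold_locales (simp add: id_func_def)
  then have "adjunction C (full_subcategory C S) F id_func \<eta>"
    using functor_F inclusion nat by (intro adjunction.intro)
  then show ?thesis using S by (simp add: reflection_def)
qed

lemma reflection_exists:
  assumes "S \<subseteq> Ob C" "replete C S"
    and "\<And>A. A \<in> Ob C \<Longrightarrow> \<exists>e. Dom C e = A \<and> universal_arrow C S e"
  shows "\<exists>F \<eta>. reflection C S F \<eta>"
proof -
  from assms(3) obtain \<eta>
    where \<eta>: "\<And>A. A \<in> Ob C \<Longrightarrow> Dom C (\<eta> A) = A \<and> universal_arrow C S (\<eta> A)" by metis
  have "\<exists>u. u \<in> hom C (Cod C (\<eta> (Dom C f))) (Cod C (\<eta> (Cod C f))) \<and>
      u \<cdot> \<eta> (Dom C f) = \<eta> (Cod C f) \<cdot> f" if f: "f \<in> Ar C" for f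
  proof -
    have d: "Dom C (\<eta> (Dom C f)) = Dom C f" "universal_arrow C S (\<eta> (Dom C f))"
      and c: "Dom C (\<eta> (Cod C f)) = Cod C f" "universal_arrow C S (\<eta> (Cod C f))"
      using \<eta> f by simp_all
    note [simp] = universal_arrowD(1)[OF c(2)] f
    obtain u where "u \<in> Ar C" "Dom C u = Cod C (\<eta> (Dom C f))"
      "Cod C u = Cod C (\<eta> (Cod C f) \<cdot> f)" "u \<cdot> \<eta> (Dom C f) = \<eta> (Cod C f) \<cdot> f"
      by (rule universal_arrow_factor[OF d(2), of "\<eta> (Cod C f) \<cdot> f"])
        (use c d universal_arrowD(2)[OF c(2)] in simp_all)
    then show ?thesis using c by (intro exI[of _ u]) (simp add: hom_def)
  qed
  then obtain F1 where F1: "\<And>f. f \<in> Ar C \<Longrightarrow>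
      F1 f \<in> hom C (Cod C (\<eta> (Dom C f))) (Cod C (\<eta> (Cod C f))) \<and>
      F1 f \<cdot> \<eta> (Dom C f) = \<eta> (Cod C f) \<cdot> f" by metis
  have "reflection C S \<lparr>on_ob = (\<lambda>A. Cod C (\<eta> A)), on_ar = F1\<rparr> \<eta>"
    by (rule reflectionI[OF assms(1,2)]) (use \<eta> F1 in auto)
  then show ?thesis by blast
qed

lemma reflections_naturally_isomorphic:
  assumes F: "reflection C S F \<eta>" and G: "reflection C S G \<theta>"
  shows "naturally_isomorphic C (full_subcategory C S) F G"
proof -
  note \<eta> = reflection_unit[OF F] and \<theta> = reflection_unit[OF G]
  note Fo = reflection_on_ob[OF F] and Go = reflection_on_ob[OF G]
  have "\<exists>i j. i \<in> hom C (on_ob F A) (on_ob G A) \<and> i \<cdot> \<eta> A = \<theta> A \<and>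
      j \<in> hom C (on_ob G A) (on_ob F A) \<and> j \<cdot> \<theta> A = \<eta> A" if A: "A \<in> Ob C" for A
  proof -
    obtain i where i: "i \<in> Ar C" "Dom C i = Cod C (\<eta> A)" "Cod C i = Cod C (\<theta> A)" "i \<cdot> \<eta> A = \<theta> A"
      by (rule universal_arrow_factor[OF \<eta>(4)[OF A], of "\<theta> A"])
        (use A \<eta> \<theta> Go in auto)
    obtain j where j: "j \<in> Ar C" "Dom C j = Cod C (\<theta> A)" "Cod C j = Cod C (\<eta> A)"
      "j \<cdot> \<theta> A = \<eta> A"
      by (rule universal_arrow_factor[OF \<theta>(4)[OF A], of "\<eta> A"])
        (use A \<eta> \<theta> Fo in auto)
    show ?thesis
      by (intro exI[of _ i] exI[of _ j]) (use i j \<eta>(3)[OF A] \<theta>(3)[OF A] in \<open>simp add: hom_def\<close>)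
  qed
  then obtain i j where ij: "\<And>A. A \<in> Ob C \<Longrightarrow>
      i A \<in> hom C (on_ob F A) (on_ob G A) \<and> i A \<cdot> \<eta> A = \<theta> A \<and>
      j A \<in> hom C (on_ob G A) (on_ob F A) \<and> j A \<cdot> \<theta> A = \<eta> A" by metis
  have i: "i A \<in> Ar C" "Dom C (i A) = on_ob F A" "Cod C (i A) = on_ob G A" "i A \<cdot> \<eta> A = \<theta> A"
    and j: "j A \<in> Ar C" "Dom C (j A) = on_ob G A" "Cod C (j A) = on_ob F A" "j A \<cdot> \<theta> A = \<eta> A"
    if "A \<in> Ob C" for A
    using ij[OF that] by (auto simp: hom_def)
  have iso: "isomorphism C (i A)" if A: "A \<in> Ob C" for A
  proof (rule isomorphismI[of "i A" "j A"])
    have Ob: "on_ob F A \<in> Ob C" "on_ob G A \<in> Ob C"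
      using Fo[OF A] Go[OF A] reflection_subset[OF F] by auto
    show "j A \<cdot> i A = Id C (Dom C (i A))"
      by (rule universal_arrow_cancel[OF \<eta>(4)[OF A]])
        (use i[OF A] j[OF A] \<eta>[OF A] Fo[OF A] Ob in auto)
    show "i A \<cdot> j A = Id C (Cod C (i A))"
      by (rule universal_arrow_cancel[OF \<theta>(4)[OF A]])
        (use i[OF A] j[OF A] \<theta>[OF A] Go[OF A] Ob in auto)
  qed (use i[OF A] j[OF A] in auto)
  have nat: "i B \<cdot> on_ar F f = on_ar G f \<cdot> i A" if f: "f \<in> Ar C" "Dom C f = A" "Cod C f = B"
    for f A B
  proof -
    have A: "A \<in> Ob C" and B: "B \<in> Ob C" using f by auto
    note Ff = reflection_on_ar[OF F f(1), unfolded f(2,3)]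
      and Gf = reflection_on_ar[OF G f(1), unfolded f(2,3)]
    note [simp] = f Ff(1-3) Gf(1-3) i(1-3)[OF A] i(1-3)[OF B] \<eta>(1-3)[OF A] \<eta>(1-3)[OF B]
    have "i B \<cdot> (on_ar F f \<cdot> \<eta> A) = on_ar G f \<cdot> (i A \<cdot> \<eta> A)"
      unfolding Ff(4) i(4)[OF A] Gf(4)
      using comp_extend[OF i(4)[OF B], of f] by simp
    then show ?thesis
      by - (rule universal_arrow_cancel[OF \<eta>(4)[OF A]], use Go[OF B] in simp_all)
  qed
  have "natural_transformation C (full_subcategory C S) F G i"
  proof (intro natural_transformation.intro natural_transformation_axioms.intro)
    show "i A \<in> hom (full_subcategory C S) (on_ob F A) (on_ob G A)" if "A \<in> Ob C" for A
      using ij[OF that] Fo[OF that] Go[OF that] by (simp add: hom_full_subcategory)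
    show "i B \<cdot>\<^bsub>full_subcategory C S\<^esub> on_ar F f = on_ar G f \<cdot>\<^bsub>full_subcategory C S\<^esub> i A"
      if "f \<in> hom C A B" for f A B
      using nat[of f A B] that by (simp add: hom_def)
  qed (rule reflection_functor[OF F] reflection_functor[OF G])+
  moreover have "isomorphism (full_subcategory C S) (i A)" if "A \<in> Ob C" for A
    using iso[OF that] i[OF that] Fo[OF that] Go[OF that]
    by (simp add: isomorphism_full_subcategory)
  ultimately show ?thesis unfolding naturally_isomorphic_def by blast
qed

end

section \<open>Composition, restriction and exactness of reflections\<close>

context category
begin

lemma universal_arrow_full_subcategory:
  assumes "universal_arrow C X e" "Dom C e \<in> Y" "X \<subseteq> Y"
  shows "universal_arrow (full_subcategory C Y) X e"
proof -
  have "hom (full_subcategory C Y) (Cod C e) (Cod C g) = hom C (Cod C e) (Cod C g)"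
    if "Cod C g \<in> X" for g
    by (rule hom_full_subcategory) (use that assms universal_arrowD(2)[OF assms(1)] in auto)
  moreover have "Cod C e \<in> Y" using universal_arrowD(2)[OF assms(1)] assms(3) by blast
  ultimately show ?thesis
    using assms(1,2) unfolding universal_arrow_def by (simp cong: conj_cong)
qed

lemma universal_arrow_comp:
  assumes e: "universal_arrow C Y e" and d: "universal_arrow (full_subcategory C Y) X d"
    and XY: "Dom C d = Cod C e" "X \<subseteq> Y" "Y \<subseteq> Ob C"
  shows "universal_arrow C X (d \<cdot> e)"
proof -
  interpret Y: category "full_subcategory C Y" by (rule category_full_subcategory[OF XY(3)])
  have [simp]: "e \<in> Ar C" "Cod C e \<in> Y" using universal_arrowD[OF e] .
  have [simp]: "d \<in> Ar C" "Cod C d \<in> X" using Y.universal_arrowD[OF d] by auto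
  have [simp]: "B \<in> Y" if "B \<in> X" for B using that XY(2) by blast
  note [simp] = XY(1)
  show ?thesis
  proof (rule universal_arrowI)
    fix g assume g: "g \<in> Ar C" "Dom C g = Dom C (d \<cdot> e)" "Cod C g \<in> X"
    obtain v where v: "v \<in> Ar C" "Dom C v = Cod C e" "Cod C v = Cod C g" "v \<cdot> e = g"
      by (rule universal_arrow_factor[OF e, of g]) (use g in simp_all)
    obtain u where u: "u \<in> Ar (full_subcategory C Y)" "Dom C u = Cod C d" "Cod C u = Cod C v"
      "u \<cdot> d = v"
      using Y.universal_arrow_factor[OF d, of v] v g by auto
    show "\<exists>u \<in> hom C (Cod C (d \<cdot> e)) (Cod C g). u \<cdot> (d \<cdot> e) = g"
      by (rule bexI[of _ u])
        (use u v comp_extend[OF u(4), of e] in \<open>simp_all add: hom_def\<close>)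
  next
    fix u v assume uv: "u \<in> Ar C" "v \<in> Ar C" "Dom C u = Cod C (d \<cdot> e)"
      "Dom C v = Cod C (d \<cdot> e)" "Cod C u = Cod C v" "Cod C v \<in> X" "u \<cdot> (d \<cdot> e) = v \<cdot> (d \<cdot> e)"
    have "u \<cdot> d = v \<cdot> d"
      by (rule universal_arrow_cancel[OF e]) (use uv in simp_all)
    then show "u = v"
      using Y.universal_arrow_cancel[OF d, of u v] uv by simp
  qed simp_all
qed

lemma reflection_restrict:
  assumes F: "reflection C X F \<eta>" and XY: "X \<subseteq> Y" "Y \<subseteq> Ob C"
  shows "reflection (full_subcategory C Y) X F \<eta>"
proof -
  interpret Y: category "full_subcategory C Y" by (rule category_full_subcategory[OF XY(2)])
  show ?thesis
  proof (rule Y.reflectionI)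
    show "replete (full_subcategory C Y) X"
      by (rule replete_full_subcategory[OF reflection_replete[OF F]])
    fix A assume "A \<in> Ob (full_subcategory C Y)"
    then have A: "A \<in> Ob C" "A \<in> Y" using XY(2) by auto
    show "Dom (full_subcategory C Y) (\<eta> A) = A \<and> Cod (full_subcategory C Y) (\<eta> A) = on_ob F A \<and>
        universal_arrow (full_subcategory C Y) X (\<eta> A)"
      using reflection_unit[OF F A(1)] A(2) XY(1)
      by (simp add: universal_arrow_full_subcategory)
  next
    fix f assume f: "f \<in> Ar (full_subcategory C Y)"
    then have "f \<in> Ar C" by simp
    from reflection_on_ar[OF F this] reflection_on_ob[OF F, of "Dom C f"]
      reflection_on_ob[OF F, of "Cod C f"] XY(1) f
    show "on_ar F f \<in> hom (full_subcategory C Y) (on_ob F (Dom (full_subcategory C Y) f))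
        (on_ob F (Cod (full_subcategory C Y) f)) \<and>
      on_ar F f \<cdot>\<^bsub>full_subcategory C Y\<^esub> \<eta> (Dom (full_subcategory C Y) f) =
      \<eta> (Cod (full_subcategory C Y) f) \<cdot>\<^bsub>full_subcategory C Y\<^esub> f"
      by (auto simp: hom_def)
  qed (use XY in simp)
qed

lemma reflection_comp:
  assumes F': "reflection C Y F' \<eta>'"
    and F'': "reflection (full_subcategory C Y) X F'' \<eta>''" and "replete C X"
  shows "reflection C X (comp_func F'' F') (\<lambda>A. \<eta>'' (on_ob F' A) \<cdot> \<eta>' A)"
proof -
  have Y: "Y \<subseteq> Ob C" by (rule reflection_subset[OF F'])
  interpret Y: category "full_subcategory C Y" by (rule category_full_subcategory[OF Y])
  have X: "X \<subseteq> Y" using Y.reflection_subset[OF F''] by simp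
  have \<eta>'': "\<eta>'' B \<in> Ar C" "Dom C (\<eta>'' B) = B" "Cod C (\<eta>'' B) = on_ob F'' B"
    if "B \<in> Y" for B
    using Y.reflection_unit(1-3)[OF F'', of B] that by simp_all
  have F''_ar: "on_ar F'' g \<in> Ar C" "Dom C (on_ar F'' g) = on_ob F'' (Dom C g)"
    "Cod C (on_ar F'' g) = on_ob F'' (Cod C g)"
    "on_ar F'' g \<cdot> \<eta>'' (Dom C g) = \<eta>'' (Cod C g) \<cdot> g"
    if "g \<in> Ar C" "Dom C g \<in> Y" "Cod C g \<in> Y" for g
    using Y.reflection_on_ar[OF F'', of g] that by simp_all
  show ?thesis
  proof (rule reflectionI)
    show "X \<subseteq> Ob C" using X Y by blast
    show "replete C X" by (rule assms(3))
    fix A assume A: "A \<in> Ob C"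
    note \<eta>' = reflection_unit[OF F' A] and B = reflection_on_ob[OF F' A]
    have "universal_arrow C X (\<eta>'' (on_ob F' A) \<cdot> \<eta>' A)"
      by (rule universal_arrow_comp[OF \<eta>'(4) Y.reflection_unit(4)[OF F'']])
        (use \<eta>' \<eta>''[OF B] B X Y in simp_all)
    then show "Dom C (\<eta>'' (on_ob F' A) \<cdot> \<eta>' A) = A \<and>
        Cod C (\<eta>'' (on_ob F' A) \<cdot> \<eta>' A) = on_ob (comp_func F'' F') A \<and>
        universal_arrow C X (\<eta>'' (on_ob F' A) \<cdot> \<eta>' A)"
      using \<eta>' \<eta>''[OF B] by (simp add: comp_func_def)
  next
    fix f assume f: "f \<in> Ar C"
    define A B where "A = Dom C f" and "B = Cod C f"
    have AB: "A \<in> Ob C" "B \<in> Ob C" and f_hom: "Dom C f = A" "Cod C f = B"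
      using f by (simp_all add: A_def B_def)
    have Y': "on_ob F' A \<in> Y" "on_ob F' B \<in> Y" using reflection_on_ob[OF F'] AB by simp_all
    note F'f = reflection_on_ar[OF F' f, unfolded f_hom]
    note F''f = F''_ar[OF F'f(1), unfolded F'f(2,3), OF Y']
    note [simp] = f f_hom F'f(1-3) F''f(1-3) reflection_unit(1-3)[OF F' AB(1)]
      reflection_unit(1-3)[OF F' AB(2)] \<eta>''[OF Y'(1)] \<eta>''[OF Y'(2)]
    have "on_ar F'' (on_ar F' f) \<cdot> (\<eta>'' (on_ob F' A) \<cdot> \<eta>' A) =
        \<eta>'' (on_ob F' B) \<cdot> (on_ar F' f \<cdot> \<eta>' A)"
      using comp_extend[OF F''f(4), of "\<eta>' A"] by simp
    also have "\<dots> = (\<eta>'' (on_ob F' B) \<cdot> \<eta>' B) \<cdot> f" unfolding F'f(4) by simp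
    finally show "on_ar (comp_func F'' F') f \<in>
        hom C (on_ob (comp_func F'' F') (Dom C f)) (on_ob (comp_func F'' F') (Cod C f)) \<and>
        on_ar (comp_func F'' F') f \<cdot> (\<eta>'' (on_ob F' (Dom C f)) \<cdot> \<eta>' (Dom C f)) =
        (\<eta>'' (on_ob F' (Cod C f)) \<cdot> \<eta>' (Cod C f)) \<cdot> f"
      by (simp add: comp_func_def hom_def)
  qed
qed

lemma protoadditive_reflection_unique:
  assumes F: "protoadditive_reflection C S F \<eta>" and G: "reflection C S G \<theta>"
  shows "protoadditive_reflection C S G \<theta>"
  unfolding protoadditive_reflection_def
proof (intro conjI allI impI)
  have RF: "reflection C S F \<eta>" using F by (simp add: protoadditive_reflection_def)
  let ?S = "full_subcategory C S"
  interpret S: category ?S by (rule category_full_subcategory[OF reflection_subset[OF RF]])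
  obtain \<tau> where \<tau>: "natural_transformation C ?S F G \<tau>"
    and iso: "\<And>A. A \<in> Ob C \<Longrightarrow> isomorphism ?S (\<tau> A)"
    using reflections_naturally_isomorphic[OF RF G] unfolding naturally_isomorphic_def by blast
  interpret \<tau>: natural_transformation C ?S F G \<tau> by (rule \<tau>)
  have comp: "Dom ?S (\<tau> A) = on_ob F A" "Cod ?S (\<tau> A) = on_ob G A" if "A \<in> Ob C" for A
    using \<tau>.component_in_hom[OF that] unfolding hom_def by auto
  have nat: "\<tau> (Cod C f) \<cdot>\<^bsub>?S\<^esub> on_ar F f = on_ar G f \<cdot>\<^bsub>?S\<^esub> \<tau> (Dom C f)" if "f \<in> Ar C" for f
    by (rule \<tau>.naturality[OF arrow_in_hom[OF that]])
  have F_ar: "Dom ?S (on_ar F f) = on_ob F (Dom C f)" "Cod ?S (on_ar F f) = on_ob F (Cod C f)"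
    and G_ar: "on_ar G f \<in> Ar ?S" "Dom ?S (on_ar G f) = on_ob G (Dom C f)"
      "Cod ?S (on_ar G f) = on_ob G (Cod C f)" if "f \<in> Ar C" for f
    using \<tau>.F.on_ar_in_hom[OF arrow_in_hom[OF that]] \<tau>.G.on_ar_in_hom[OF arrow_in_hom[OF that]]
    unfolding hom_def by auto
  fix k f s assume kfs: "split_short_exact C k f s"
  then have ker: "is_kernel C k f" by (simp add: split_short_exact_def short_exact_def)
  note [simp del] = full_subcategory_simps
  note [simp] = is_kernelD(1-3)[OF ker] F_ar[OF is_kernelD(1)[OF ker]]
    F_ar[OF is_kernelD(2)[OF ker]] G_ar[OF is_kernelD(1)[OF ker]]
    G_ar[OF is_kernelD(2)[OF ker]]
  show "short_exact ?S (on_ar G k) (on_ar G f)"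
  proof (rule S.short_exact_isomorphic)
    show "short_exact ?S (on_ar F k) (on_ar F f)"
      using F kfs unfolding protoadditive_reflection_def by blast
    show "isomorphism ?S (\<tau> (Dom C k))" "isomorphism ?S (\<tau> (Dom C f))"
      "isomorphism ?S (\<tau> (Cod C f))"
      by (simp_all add: iso)
    show "\<tau> (Dom C f) \<cdot>\<^bsub>?S\<^esub> on_ar F k = on_ar G k \<cdot>\<^bsub>?S\<^esub> \<tau> (Dom C k)"
      using nat[of k] by simp
    show "\<tau> (Cod C f) \<cdot>\<^bsub>?S\<^esub> on_ar F f = on_ar G f \<cdot>\<^bsub>?S\<^esub> \<tau> (Dom C f)"
      using nat[of f] by simp
  qed (simp_all add: comp)
qed (rule G)

lemma reflection_zero_object:
  assumes F: "reflection C S F \<eta>" and Z: "zero_object C Z"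
  shows "Z \<in> S"
proof -
  have [simp]: "Z \<in> Ob C" by (rule zero_object_Ob[OF Z])
  note \<eta> [simp] = reflection_unit(1-3)[OF F \<open>Z \<in> Ob C\<close>]
  have S: "on_ob F Z \<in> S" by (rule reflection_on_ob[OF F \<open>Z \<in> Ob C\<close>])
  then have Ob [simp]: "on_ob F Z \<in> Ob C" using reflection_subset[OF F] by blast
  obtain r where "r \<in> hom C (on_ob F Z) Z" using zero_object_arrows[OF Z Ob] by blast
  then have r [simp]: "r \<in> Ar C" "Dom C r = on_ob F Z" "Cod C r = Z" by (auto simp: hom_def)
  have r\<eta>: "r \<cdot> \<eta> Z = Id C Z"
    by (rule zero_object_hom[OF Z, of _ Z]) (simp_all add: hom_def)
  have "\<eta> Z \<cdot> r = Id C (on_ob F Z)"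
    by (rule universal_arrow_cancel[OF reflection_unit(4)[OF F \<open>Z \<in> Ob C\<close>]])
      (use S r\<eta> in simp_all)
  then have "isomorphism C r"
    by - (rule isomorphismI[of r "\<eta> Z"], use r\<eta> in simp_all)
  then show ?thesis
    using reflection_replete[OF F] S r unfolding replete_def by metis
qed

text \<open>The inclusion of a reflective subcategory is a right adjoint, hence it preserves
  monomorphisms and kernels.\<close>

lemma monic_reflective:
  assumes F: "reflection C S F \<eta>" and m: "monic (full_subcategory C S) m"
  shows "monic C m"
proof (rule monicI)
  interpret S: category "full_subcategory C S"
    by (rule category_full_subcategory[OF reflection_subset[OF F]])
  have [simp]: "m \<in> Ar C" "Dom C m \<in> S" "Cod C m \<in> S" using S.monic_arrow[OF m] by auto
  show "m \<in> Ar C" by simp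
  fix f g assume f: "f \<in> Ar C" "Cod C f = Dom C m" and g: "g \<in> Ar C" "Cod C g = Dom C m"
    and fg: "Dom C f = Dom C g" "m \<cdot> f = m \<cdot> g"
  have D: "Dom C g \<in> Ob C" using g by simp
  note \<eta> [simp] = reflection_unit(1-3)[OF F D] and S = reflection_on_ob[OF F D]
  obtain f' where f': "f' \<in> Ar C" "Dom C f' = on_ob F (Dom C g)" "Cod C f' = Dom C m"
    "f' \<cdot> \<eta> (Dom C g) = f"
    by (rule universal_arrow_factor[OF reflection_unit(4)[OF F D], of f]) (use f fg in auto)
  obtain g' where g': "g' \<in> Ar C" "Dom C g' = on_ob F (Dom C g)" "Cod C g' = Dom C m"
    "g' \<cdot> \<eta> (Dom C g) = g"
    by (rule universal_arrow_factor[OF reflection_unit(4)[OF F D], of g]) (use g in auto)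
  have "m \<cdot> f' = m \<cdot> g'"
    by (rule universal_arrow_cancel[OF reflection_unit(4)[OF F D]])
      (use f' g' fg in simp_all)
  then have "f' = g'"
    by - (rule S.monic_cancel[OF m], use f' g' S in simp_all)
  then show "f = g" using f'(4) g'(4) by simp
qed

lemma is_kernel_reflective:
  assumes F: "reflection C S F \<eta>" and Z: "zero_object C Z"
    and k: "is_kernel (full_subcategory C S) k f"
  shows "is_kernel C k f"
proof (rule is_kernelI)
  interpret S: category "full_subcategory C S"
    by (rule category_full_subcategory[OF reflection_subset[OF F]])
  have Ob: "S \<subseteq> Ob C" and ZS: "Z \<in> S"
    using reflection_subset[OF F] reflection_zero_object[OF F Z] by auto
  note zero = zero_arrow_full_subcategory[OF Z ZS Ob]
  have [simp]: "k \<in> Ar C" "Dom C k \<in> S" "f \<in> Ar C" "Dom C f \<in> S" "Cod C f \<in> S"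
    and eq [simp]: "Cod C k = Dom C f"
    using S.is_kernelD[OF k] by auto
  show "monic C k" by (rule monic_reflective[OF F S.is_kernel_monic[OF k]])
  show "f \<in> Ar C" "Cod C k = Dom C f" by simp_all
  show "zero_arrow C (f \<cdot> k)" using S.is_kernelD(4)[OF k] by (simp add: zero)
  fix h assume h: "h \<in> Ar C" "Cod C h = Dom C f" "zero_arrow C (f \<cdot> h)"
  have D: "Dom C h \<in> Ob C" using h by simp
  note \<eta> [simp] = reflection_unit(1-3)[OF F D] and S [simp] = reflection_on_ob[OF F D]
  obtain h' where h': "h' \<in> Ar C" "Dom C h' = on_ob F (Dom C h)" "Cod C h' = Dom C f"
    "h' \<cdot> \<eta> (Dom C h) = h"
    by (rule universal_arrow_factor[OF reflection_unit(4)[OF F D], of h]) (use h in auto)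
  have "pointed C" using Z unfolding pointed_def by blast
  moreover have "on_ob F (Dom C h) \<in> Ob C" "Cod C f \<in> Ob C" using S Ob by auto
  ultimately obtain z where z: "zero_arrow C z" "z \<in> Ar C" "Dom C z = on_ob F (Dom C h)"
    "Cod C z = Cod C f" by (rule zero_arrow_exists)
  have "f \<cdot> h = z \<cdot> \<eta> (Dom C h)"
    by (rule zero_arrow_unique[OF h(3) zero_arrow_comp_right[OF z(1)]]) (use z h in simp_all)
  then have "f \<cdot> h' = z"
    by - (rule universal_arrow_cancel[OF reflection_unit(4)[OF F D]], use h' z in simp_all)
  then have "zero_arrow (full_subcategory C S) (f \<cdot>\<^bsub>full_subcategory C S\<^esub> h')"
    using z by (simp add: zero)
  then obtain u where u: "u \<in> Ar (full_subcategory C S)" "Dom C u = Dom C h'"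
    "Cod C u = Dom C k" "k \<cdot> u = h'"
    using S.is_kernel_factor[OF k, of h'] h' by auto
  show "\<exists>u \<in> hom C (Dom C h) (Dom C k). k \<cdot> u = h"
    by (rule bexI[of _ "u \<cdot> \<eta> (Dom C h)"])
      (use u h' comp_extend[OF u(4), of "\<eta> (Dom C h)"] in \<open>simp_all add: hom_def\<close>)
qed

end

section \<open>Split epimorphisms in homological categories\<close>

context category
begin

lemma section_ofD:
  assumes "section_of C s f"
  shows "f \<in> Ar C" "s \<in> Ar C" "Dom C s = Cod C f" "Cod C s = Dom C f"
    "f \<cdot> s = Id C (Cod C f)"
  using assms unfolding section_of_def hom_def by auto

lemma section_ofI:
  assumes "f \<in> Ar C" "s \<in> Ar C" "Dom C s = Cod C f" "Cod C s = Dom C f"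
    "f \<cdot> s = Id C (Cod C f)"
  shows "section_of C s f"
  using assms unfolding section_of_def hom_def by auto

lemma section_of_full_subcategory:
  "section_of (full_subcategory C S) s f \<longleftrightarrow>
    section_of C s f \<and> Dom C f \<in> S \<and> Cod C f \<in> S"
  unfolding section_of_def by (auto simp: hom_full_subcategory_iff)

text \<open>Protomodularity in the form in which it is used: the kernel and the section of a split
  epimorphism are jointly strongly epic. If both factor through the subobject \<open>m\<close>, then \<open>f \<cdot> m\<close>
  is again split with the same kernel, and protomodularity compares the two split
  epimorphisms.\<close>

lemma kernel_section_strongly_epic:
  assumes "protomodular C" and k: "is_kernel C k f" and s: "section_of C s f"
    and m: "monic C m" "Cod C m = Dom C f"
    and k': "k' \<in> Ar C" "Cod C k' = Dom C m" "m \<cdot> k' = k"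
    and s': "s' \<in> Ar C" "Cod C s' = Dom C m" "m \<cdot> s' = s"
  shows "isomorphism C m"
proof -
  note [simp] = monic_arrow[OF m(1)] m(2) k'(1,2) s'(1,2) is_kernelD(1-3)[OF k]
    section_ofD(1-4)[OF s]
  have dom [simp]: "Dom C k' = Dom C k" "Dom C s' = Cod C f"
    using k' s' section_ofD(3)[OF s] comp_arrow(2)[of k' m] comp_arrow(2)[of s' m] by simp_all
  have "is_kernel C k' (f \<cdot> m)"
  proof (rule is_kernelI)
    show "monic C k'"
      by (rule monic_of_comp[of m]) (use is_kernel_monic[OF k] k' in simp_all)
    show "zero_arrow C ((f \<cdot> m) \<cdot> k')" using is_kernelD(4)[OF k] k' by simp
    fix h assume h: "h \<in> Ar C" "Cod C h = Dom C (f \<cdot> m)" "zero_arrow C ((f \<cdot> m) \<cdot> h)"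
    obtain u where u: "u \<in> Ar C" "Dom C u = Dom C (m \<cdot> h)" "Cod C u = Dom C k" "k \<cdot> u = m \<cdot> h"
      by (rule is_kernel_factor[OF k, of "m \<cdot> h"]) (use h in simp_all)
    have "k' \<cdot> u = h"
      by (rule monic_cancel[OF m(1)]) (use u h comp_extend[OF k'(3), of u] in simp_all)
    then show "\<exists>u \<in> hom C (Dom C h) (Dom C k'). k' \<cdot> u = h"
      using u h by (intro bexI[of _ u]) (simp_all add: hom_def)
  qed simp_all
  moreover have "section_of C s' (f \<cdot> m)"
    by (rule section_ofI) (use section_ofD(5)[OF s] s' in simp_all)
  moreover have "m \<cdot> k' = k \<cdot> Id C (Dom C k)" using k' by simp
  moreover have "Id C (Cod C f) \<cdot> (f \<cdot> m) = f \<cdot> m" by simp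
  moreover have "m \<cdot> s' = s \<cdot> Id C (Cod C f)" using s' by simp
  moreover have "isomorphism C (Id C (Dom C k))" "isomorphism C (Id C (Cod C f))"
    by (simp_all add: isomorphism_Id)
  moreover have "Id C (Dom C k) \<in> hom C (Dom C k') (Dom C k)"
    "m \<in> hom C (Dom C (f \<cdot> m)) (Dom C f)" "Id C (Cod C f) \<in> hom C (Cod C (f \<cdot> m)) (Cod C f)"
    by (simp_all add: hom_def)
  ultimately show ?thesis
    using assms(1) k s unfolding protomodular_def by blast
qed

text \<open>If \<open>h\<close> kills the kernel of \<open>f\<close>, then \<open>h\<close> and \<open>h \<cdot> s \<cdot> f\<close> agree on the kernel and on
  the section, so their equalizer is everything.\<close>

lemma split_epi_is_cokernel:
  assumes "protomodular C" "finitely_complete C"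
    and k: "is_kernel C k f" and s: "section_of C s f"
  shows "is_cokernel C f k"
  unfolding is_cokernel_def
proof (intro conjI ballI impI)
  note [simp] = is_kernelD(1-3)[OF k] section_ofD(2-4)[OF s]
  show "zero_arrow C (f \<cdot> k)" by (rule is_kernelD(4)[OF k])
  fix h assume h: "h \<in> Ar C" "Dom C h = Cod C k \<and> zero_arrow C (h \<cdot> k)"
  then have [simp]: "h \<in> Ar C" "Dom C h = Dom C f" and hk: "zero_arrow C (h \<cdot> k)" by simp_all
  have hsf_hk: "(h \<cdot> (s \<cdot> f)) \<cdot> k = h \<cdot> k"
  proof (rule zero_arrow_unique[OF _ hk])
    have "zero_arrow C ((h \<cdot> s) \<cdot> (f \<cdot> k))"
      by (rule zero_arrow_comp_left[OF is_kernelD(4)[OF k]]) simp_all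
    then show "zero_arrow C ((h \<cdot> (s \<cdot> f)) \<cdot> k)" by simp
  qed simp_all
  obtain e where e: "monic C e" "Cod C e = Dom C h" "h \<cdot> e = (h \<cdot> (s \<cdot> f)) \<cdot> e"
    and eq: "\<And>x. x \<in> Ar C \<Longrightarrow> Cod C x = Dom C h \<Longrightarrow> h \<cdot> x = (h \<cdot> (s \<cdot> f)) \<cdot> x \<Longrightarrow>
      \<exists>u \<in> hom C (Dom C x) (Dom C e). e \<cdot> u = x"
    by (rule equalizer_exists[OF assms(2), of h "h \<cdot> (s \<cdot> f)"]) simp_all
  obtain k' where k': "k' \<in> hom C (Dom C k) (Dom C e)" "e \<cdot> k' = k"
    using eq[of k] hsf_hk by auto
  obtain s' where s': "s' \<in> hom C (Dom C s) (Dom C e)" "e \<cdot> s' = s"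
    using eq[of s] section_ofD(5)[OF s] by auto
  have "isomorphism C e"
    by (rule kernel_section_strongly_epic[OF assms(1) k s e(1)])
      (use e(2) k' s' in \<open>auto simp: hom_def\<close>)
  then obtain d where d: "d \<in> Ar C" "Dom C d = Cod C e" "Cod C d = Dom C e"
    "e \<cdot> d = Id C (Cod C e)" by (rule isomorphism_inverse)
  have [simp]: "e \<in> Ar C" "Cod C e = Dom C f" using monic_arrow[OF e(1)] e(2) by simp_all
  have "(h \<cdot> e) \<cdot> d = ((h \<cdot> (s \<cdot> f)) \<cdot> e) \<cdot> d" using e(3) by simp
  then have hsf: "h \<cdot> (s \<cdot> f) = h" using d by simp
  show "\<exists>!u. u \<in> hom C (Cod C f) (Cod C h) \<and> u \<cdot> f = h"
  proof (rule ex1I[of _ "h \<cdot> s"])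
    show "h \<cdot> s \<in> hom C (Cod C f) (Cod C h) \<and> (h \<cdot> s) \<cdot> f = h"
      using hsf by (simp add: hom_def)
    fix u assume u: "u \<in> hom C (Cod C f) (Cod C h) \<and> u \<cdot> f = h"
    then have [simp]: "u \<in> Ar C" "Dom C u = Cod C f" by (auto simp: hom_def)
    have "u \<cdot> (f \<cdot> s) = h \<cdot> s" by (rule comp_extend) (use u in simp_all)
    then show "u = h \<cdot> s" using section_ofD(5)[OF s] by simp
  qed
qed (use is_kernelD[OF k] in auto)

lemma pullback_commute:
  assumes "pullback C f g p q"
  shows "pullback C g f q p"
proof -
  note [simp] = pullbackD(1-8)[OF assms]
  have "\<exists>!u. u \<in> hom C Z (Dom C q) \<and> q \<cdot> u = a \<and> p \<cdot> u = b"
    if ab: "a \<in> hom C Z (Dom C g)" "b \<in> hom C Z (Dom C f)" "g \<cdot> a = f \<cdot> b" for Z a b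
  proof -
    have "\<exists>!u. u \<in> hom C (Dom C b) (Dom C p) \<and> p \<cdot> u = b \<and> q \<cdot> u = a"
      by (rule pullback_factor[OF assms]) (use ab in \<open>auto simp: hom_def\<close>)
    then show ?thesis using ab(2) by (simp add: hom_def conj_commute conj_left_commute)
  qed
  then show ?thesis
    unfolding pullback_def using pullbackD(9)[OF assms] by (simp add: hom_def)
qed

text \<open>A regular epimorphism \<open>e\<close> is its own image factorization, with an identity as the
  monomorphism, so stability of image factorizations under pullback applies to it.\<close>

lemma regular_epi_pullback:
  assumes "regular_category C" and pb: "pullback C e g p e'" and e: "regular_epi C e"
  shows "regular_epi C e'"
proof -
  note [simp] = pullbackD(1-8)[OF pb]
  let ?I = "Id C (Cod C e)" and ?J = "Id C (Dom C g)"
  have "regular_factorization C e e ?I"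
    using e by (simp add: regular_factorization_def monic_Id)
  moreover have "pullback C ?I g g ?J"
    unfolding pullback_def
  proof (intro conjI allI ballI impI)
    fix Z a b assume ab: "a \<in> hom C Z (Dom C ?I)" "b \<in> hom C Z (Dom C g)" "?I \<cdot> a = g \<cdot> b"
    have "?I \<cdot> a = a" using ab(1) by (auto simp: hom_def)
    then have a: "g \<cdot> b = a" using ab(3) by simp
    have J: "?J \<cdot> u = u" if "u \<in> hom C Z (Dom C g)" for u using that by (auto simp: hom_def)
    show "\<exists>!u. u \<in> hom C Z (Dom C g) \<and> g \<cdot> u = a \<and> ?J \<cdot> u = b"
    proof (rule ex1I[of _ b])
      show "b \<in> hom C Z (Dom C g) \<and> g \<cdot> b = a \<and> ?J \<cdot> b = b"
        using ab(2) a J[OF ab(2)] by blast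
    next
      fix u assume u: "u \<in> hom C Z (Dom C g) \<and> g \<cdot> u = a \<and> ?J \<cdot> u = b"
      then show "u = b" using J[of u] by metis
    qed
  qed (simp_all add: hom_def)
  ultimately have "regular_factorization C (?J \<cdot> e') e' ?J"
    using pb assms(1) unfolding regular_category_def by blast
  then show ?thesis by (simp add: regular_factorization_def)
qed

lemma homologicalD:
  assumes "homological C"
  shows "finitely_complete C" "pointed C" "regular_category C" "protomodular C"
  using assms by (simp_all add: homological_def)

text \<open>Let the split epimorphism \<open>f'\<close> be a quotient of the split epimorphism \<open>f\<close> along \<open>v\<close> and
  \<open>w\<close>. Then the kernel of \<open>f\<close> maps onto the kernel \<open>l\<close> of \<open>f'\<close>, so a subobject \<open>j\<close> of the
  latter that receives the former must be all of it. In groups, an element of the kernel of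
  \<open>f'\<close> lifts to some \<open>a\<close>, and \<open>a\<close> times the inverse of \<open>s (f a)\<close> is a lift in the kernel of
  \<open>f\<close>. In general, let \<open>Q\<close> be the inverse image of \<open>l\<close> under \<open>v\<close> (with inclusion \<open>q\<close> and
  projection \<open>r\<close>) and \<open>\<omega>\<close> the kernel of \<open>w\<close>. Then \<open>f\<close> restricts to a split epimorphism \<open>\<phi>\<close>
  from \<open>Q\<close> to the domain of \<open>\<omega>\<close> with the same kernel \<open>\<kappa>\<close>, while \<open>r\<close> kills its section \<open>\<sigma>\<close>.
  The inverse image of \<open>j\<close> under \<open>r\<close> contains \<open>\<kappa>\<close> and \<open>\<sigma>\<close>, so it is all of \<open>Q\<close>, and the regular
  epimorphism \<open>r\<close> factors through \<open>j\<close>.\<close>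

lemma kernel_of_split_quotient:
  assumes C: "homological C"
    and ker: "is_kernel C k f" and sec: "section_of C s f"
    and v: "regular_epi C v" "Dom C v = Dom C f"
    and w: "w \<in> Ar C" "Dom C w = Cod C f"
    and f': "f' \<in> Ar C" "Dom C f' = Cod C v" "Cod C f' = Cod C w" "w \<cdot> f = f' \<cdot> v"
    and s': "s' \<in> Ar C" "Dom C s' = Cod C w" "Cod C s' = Cod C v" "v \<cdot> s = s' \<cdot> w"
    and j: "monic C j" "Cod C j = Cod C v" "zero_arrow C (f' \<cdot> j)"
    and e: "e \<in> Ar C" "Dom C e = Dom C k" "Cod C e = Dom C j" "v \<cdot> k = j \<cdot> e"
  shows "is_kernel C j f'"
proof -
  note fin = homologicalD(1)[OF C] and pointed = homologicalD(2)[OF C]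
  note [simp] = is_kernelD(1-3)[OF ker] section_ofD(2-4)[OF sec] regular_epi_arrow[OF v(1)]
    v(2) w f'(1-3) s'(1-3) monic_arrow[OF j(1)] j(2) e(1-3)
  obtain l where l: "is_kernel C l f'" by (rule kernel_exists[OF fin pointed f'(1)])
  have [simp]: "l \<in> Ar C" "Cod C l = Cod C v" using is_kernelD[OF l] by simp_all
  obtain n where n [simp]: "n \<in> Ar C" "Dom C n = Dom C j" "Cod C n = Dom C l"
    and ln: "l \<cdot> n = j" by (rule is_kernel_factor[OF l _ _ j(3)]) simp_all
  have "monic C n" by (rule monic_of_comp[of l]) (use ln j(1) in simp_all)
  obtain q r where Q: "pullback C v l q r" by (rule pullback_exists[OF fin, of v l]) simp_all
  note [simp] = pullbackD(3,4,6,7,8)[OF Q]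
  have "monic C q"
    by (rule pullback_monic[OF pullback_commute[OF Q] is_kernel_monic[OF l]])
  have "regular_epi C r" by (rule regular_epi_pullback[OF homologicalD(3)[OF C] Q v(1)])
  obtain \<omega> where \<omega>: "is_kernel C \<omega> w" by (rule kernel_exists[OF fin pointed w(1)])
  have [simp]: "\<omega> \<in> Ar C" "Cod C \<omega> = Cod C f" using is_kernelD[OF \<omega>] by simp_all
  have wfq: "w \<cdot> (f \<cdot> q) = (f' \<cdot> l) \<cdot> r"
    using comp_extend[OF f'(4), of q] pullbackD(9)[OF Q] by simp
  obtain \<phi> where \<phi> [simp]: "\<phi> \<in> Ar C" "Dom C \<phi> = Dom C q" "Cod C \<phi> = Dom C \<omega>"
    and \<omega>\<phi>: "\<omega> \<cdot> \<phi> = f \<cdot> q"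
    by (rule is_kernel_factor[OF \<omega>, of "f \<cdot> q"])
      (unfold wfq, simp_all add: zero_arrow_comp_right[OF is_kernelD(4)[OF l]] del: assoc)
  have \<omega>\<phi>x: "\<omega> \<cdot> (\<phi> \<cdot> x) = f \<cdot> (q \<cdot> x)" if "x \<in> Ar C" "Cod C x = Dom C q" for x
    using comp_extend[OF \<omega>\<phi>, of x] that by simp
  have "v \<cdot> k = l \<cdot> (n \<cdot> e)" using comp_extend[OF ln, of e] e(4) by simp
  then obtain \<kappa> where \<kappa> [simp]: "\<kappa> \<in> Ar C" "Dom C \<kappa> = Dom C k" "Cod C \<kappa> = Dom C q"
    and q\<kappa>: "q \<cdot> \<kappa> = k" and r\<kappa>: "r \<cdot> \<kappa> = n \<cdot> e"
    by - (rule pullback_lift[OF Q, of k "n \<cdot> e"], simp_all)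
  obtain z where z: "zero_arrow C z" and z_ar [simp]: "z \<in> Ar C" "Dom C z = Dom C \<omega>"
    "Cod C z = Dom C j" by (rule zero_arrow_exists[OF pointed, of "Dom C \<omega>" "Dom C j"]) simp_all
  have "v \<cdot> (s \<cdot> \<omega>) = l \<cdot> (n \<cdot> z)"
  proof (rule zero_arrow_unique)
    have "zero_arrow C (s' \<cdot> (w \<cdot> \<omega>))"
      by (rule zero_arrow_comp_left[OF is_kernelD(4)[OF \<omega>]]) simp_all
    then show "zero_arrow C (v \<cdot> (s \<cdot> \<omega>))" using comp_extend[OF s'(4), of \<omega>] by simp
    show "zero_arrow C (l \<cdot> (n \<cdot> z))"
      by (rule zero_arrow_comp_left[OF zero_arrow_comp_left[OF z]]) simp_all
  qed simp_all
  then obtain \<sigma> where \<sigma> [simp]: "\<sigma> \<in> Ar C" "Dom C \<sigma> = Dom C \<omega>" "Cod C \<sigma> = Dom C q"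
    and q\<sigma>: "q \<cdot> \<sigma> = s \<cdot> \<omega>" and r\<sigma>: "r \<cdot> \<sigma> = n \<cdot> z"
    by - (rule pullback_lift[OF Q, of "s \<cdot> \<omega>" "n \<cdot> z"], simp_all)
  have "section_of C \<sigma> \<phi>"
  proof (rule section_ofI)
    show "\<phi> \<cdot> \<sigma> = Id C (Cod C \<phi>)"
      by (rule monic_cancel[OF is_kernel_monic[OF \<omega>]])
        (use \<omega>\<phi>x[of \<sigma>] q\<sigma> comp_extend[OF section_ofD(5)[OF sec], of \<omega>] in simp_all)
  qed simp_all
  moreover have "is_kernel C \<kappa> \<phi>"
  proof (rule is_kernelI)
    show "monic C \<kappa>"
      by (rule monic_of_comp[of q]) (use q\<kappa> is_kernel_monic[OF ker] in simp_all)
    show "zero_arrow C (\<phi> \<cdot> \<kappa>)"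
      by (rule monic_reflects_zero[OF pointed is_kernel_monic[OF \<omega>]])
        (use \<omega>\<phi>x[of \<kappa>] q\<kappa> is_kernelD(4)[OF ker] in simp_all)
    fix h assume h: "h \<in> Ar C" "Cod C h = Dom C \<phi>" "zero_arrow C (\<phi> \<cdot> h)"
    have "zero_arrow C (\<omega> \<cdot> (\<phi> \<cdot> h))"
      by (rule zero_arrow_comp_left[OF h(3)]) (use h in simp_all)
    then have "zero_arrow C (f \<cdot> (q \<cdot> h))" using \<omega>\<phi>x[of h] h by simp
    then obtain u where u: "u \<in> Ar C" "Dom C u = Dom C (q \<cdot> h)" "Cod C u = Dom C k"
      "k \<cdot> u = q \<cdot> h"
      by - (rule is_kernel_factor[OF ker, of "q \<cdot> h"], use h in simp_all)
    have "\<kappa> \<cdot> u = h"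
      by (rule monic_cancel[OF \<open>monic C q\<close>]) (use u h comp_extend[OF q\<kappa>, of u] in simp_all)
    then show "\<exists>u \<in> hom C (Dom C h) (Dom C \<kappa>). \<kappa> \<cdot> u = h"
      using u h by (intro bexI[of _ u]) (simp_all add: hom_def)
  qed simp_all
  moreover obtain p t where T: "pullback C n r p t"
    by (rule pullback_exists[OF fin, of n r]) simp_all
  note [simp] = pullbackD(3,4,6,7,8)[OF T]
  have "monic C t" by (rule pullback_monic[OF T \<open>monic C n\<close>])
  moreover obtain \<kappa>' where "\<kappa>' \<in> Ar C" "Dom C \<kappa>' = Dom C e" "Cod C \<kappa>' = Dom C p" "t \<cdot> \<kappa>' = \<kappa>"
    by (rule pullback_lift[OF T, of e \<kappa>]) (use r\<kappa> in simp_all)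
  moreover obtain \<sigma>' where "\<sigma>' \<in> Ar C" "Dom C \<sigma>' = Dom C z" "Cod C \<sigma>' = Dom C p" "t \<cdot> \<sigma>' = \<sigma>"
    by (rule pullback_lift[OF T, of z \<sigma>]) (use r\<sigma> in simp_all)
  ultimately have "isomorphism C t"
    by - (rule kernel_section_strongly_epic[OF homologicalD(4)[OF C], of \<kappa> \<phi> \<sigma> t \<kappa>' \<sigma>'],
        simp_all)
  then obtain t' where t' [simp]: "t' \<in> Ar C" "Dom C t' = Cod C t" "Cod C t' = Dom C t"
    and tt': "t \<cdot> t' = Id C (Cod C t)" by (rule isomorphism_inverse)
  have "r = n \<cdot> (p \<cdot> t')"
    using comp_extend[OF pullbackD(9)[OF T], of t'] tt' by simp
  then have "isomorphism C n"
    by - (rule regular_epi_through_monic[OF \<open>regular_epi C r\<close> \<open>monic C n\<close>, of "p \<cdot> t'"], simp_all)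
  then obtain n' where n': "n' \<in> Ar C" "Dom C n' = Cod C n" "Cod C n' = Dom C n"
    and nn': "n \<cdot> n' = Id C (Cod C n)" by (rule isomorphism_inverse)
  have jn': "j \<cdot> n' = l" using ln nn' n' assoc[of n' n l] by simp
  show ?thesis
  proof (rule is_kernelI[OF j(1) _ _ j(3)])
    fix h assume h: "h \<in> Ar C" "Cod C h = Dom C f'" "zero_arrow C (f' \<cdot> h)"
    then obtain u where u: "u \<in> Ar C" "Dom C u = Dom C h" "Cod C u = Dom C l" "l \<cdot> u = h"
      by (rule is_kernel_factor[OF l])
    then show "\<exists>u \<in> hom C (Dom C h) (Dom C j). j \<cdot> u = h"
      using n' comp_extend[OF jn', of u] by (intro bexI[of _ "n' \<cdot> u"]) (simp_all add: hom_def)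
  qed simp_all
qed

end

section \<open>The closure of a reflective subcategory under subobjects\<close>

context category
begin

lemma subobject_closure_subset: "subobject_closure C X \<subseteq> Ob C"
  by (auto simp: subobject_closure_def)

lemma subset_subobject_closure:
  assumes "X \<subseteq> Ob C"
  shows "X \<subseteq> subobject_closure C X"
proof
  fix A assume "A \<in> X"
  with assms have "A \<in> Ob C" "A \<in> X" by auto
  then show "A \<in> subobject_closure C X"
    using monic_Id[of A] Id_in_hom[of A] unfolding subobject_closure_def by blast
qed

lemma subobject_closure_monic:
  assumes "Y \<in> subobject_closure C X"
  obtains n where "monic C n" "Dom C n = Y" "Cod C n \<in> X"
  using assms unfolding subobject_closure_def hom_def by blast

lemma subobject_closure_closed:
  assumes "monic C m" "Cod C m \<in> subobject_closure C X"
  shows "Dom C m \<in> subobject_closure C X"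
proof -
  obtain n where n: "monic C n" "Dom C n = Cod C m" "Cod C n \<in> X"
    by (rule subobject_closure_monic[OF assms(2)])
  have "monic C (n \<cdot> m)" by (rule monic_comp[OF assms(1) n(1,2)])
  moreover have "n \<cdot> m \<in> hom C (Dom C m) (Cod C n)"
    using n monic_arrow[OF assms(1)] monic_arrow[OF n(1)] by (simp add: hom_def)
  moreover have "Dom C m \<in> Ob C" using monic_arrow[OF assms(1)] by simp
  ultimately show ?thesis using n(3) unfolding subobject_closure_def by blast
qed

lemma replete_subobject_closure: "replete C (subobject_closure C X)"
  unfolding replete_def
proof (intro allI impI)
  fix f assume f: "isomorphism C f \<and> Dom C f \<in> subobject_closure C X"
  then obtain g where g: "g \<in> Ar C" "Dom C g = Cod C f" "Cod C g = Dom C f"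
    "g \<cdot> f = Id C (Dom C f)" "f \<cdot> g = Id C (Cod C f)" by (auto elim: isomorphism_inverse)
  have "isomorphism C g"
    by (rule isomorphismI[of g f]) (use f g isomorphism_arrow in auto)
  then show "Cod C f \<in> subobject_closure C X"
    using subobject_closure_closed[OF isomorphism_monic, of g X] f g by simp
qed

text \<open>The image of the unit of the reflection onto \<open>X\<close> is the universal quotient of \<open>A\<close> lying in
  the subobject closure: an arrow into a subobject of an object of \<open>X\<close> extends along the unit
  after composition with the inclusion, and orthogonality lifts it back.\<close>

lemma reflection_subobject_closure_exists:
  assumes C: "regular_category C" and F: "reflection C X F \<eta>"
  shows "\<exists>F' \<eta>'. reflection C (subobject_closure C X) F' \<eta>'"
proof (rule reflection_exists[OF subobject_closure_subset replete_subobject_closure])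
  let ?Y = "subobject_closure C X"
  fix A assume A: "A \<in> Ob C"
  note \<eta> [simp] = reflection_unit(1-3)[OF F A]
  obtain e m where "regular_factorization C (\<eta> A) e m"
    using C \<eta>(1) unfolding regular_category_def by blast
  then have e: "regular_epi C e" and m: "monic C m" and em [simp]: "Dom C m = Cod C e"
    and \<eta>_eq: "\<eta> A = m \<cdot> e" by (auto simp: regular_factorization_def)
  note [simp] = regular_epi_arrow[OF e] monic_arrow[OF m]
  have dom: "Dom C e = A" and cod: "Cod C m = on_ob F A" using \<eta>(2,3) \<eta>_eq by auto
  have Fy: "on_ob F A \<in> ?Y"
    using reflection_on_ob[OF F A] subset_subobject_closure[OF reflection_subset[OF F]] by blast
  have "universal_arrow C ?Y e"
  proof (rule universal_arrowI)
    show "Cod C e \<in> ?Y" using subobject_closure_closed[OF m] cod Fy by simp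
    fix g assume g: "g \<in> Ar C" "Dom C g = Dom C e" "Cod C g \<in> ?Y"
    obtain n where n: "monic C n" "Dom C n = Cod C g" "Cod C n \<in> X"
      by (rule subobject_closure_monic[OF g(3)])
    note [simp] = monic_arrow[OF n(1)] n(2) g(1,2) dom cod
    obtain u where u: "u \<in> Ar C" "Dom C u = Cod C (\<eta> A)" "Cod C u = Cod C (n \<cdot> g)"
      "u \<cdot> \<eta> A = n \<cdot> g"
      by (rule universal_arrow_factor[OF reflection_unit(4)[OF F A], of "n \<cdot> g"])
        (use n in simp_all)
    have "n \<cdot> g = (u \<cdot> m) \<cdot> e" using u \<eta>_eq by simp
    then obtain t where "t \<in> Ar C" "Dom C t = Cod C e" "Cod C t = Cod C g" "t \<cdot> e = g"
      by - (rule regular_epi_fill_in[OF e n(1), of g "u \<cdot> m"], use u in simp_all)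
    then show "\<exists>u \<in> hom C (Cod C e) (Cod C g). u \<cdot> e = g" by (auto simp: hom_def)
  next
    show "u = v" if "u \<in> Ar C" "v \<in> Ar C" "Dom C u = Cod C e" "Dom C v = Cod C e"
      "Cod C u = Cod C v" "u \<cdot> e = v \<cdot> e" for u v
      by (rule regular_epi_cancel[OF e]) (use that in auto)
  qed simp
  then show "\<exists>e. Dom C e = A \<and> universal_arrow C ?Y e" using dom by blast
qed

text \<open>The image of the unit already lies in the subcategory, so the inclusion of the image splits
  by universality.\<close>

lemma reflection_unit_regular_epi:
  assumes C: "regular_category C" and F: "reflection C Y F \<eta>" and A: "A \<in> Ob C"
    and closed: "\<And>m. monic C m \<Longrightarrow> Cod C m \<in> Y \<Longrightarrow> Dom C m \<in> Y"
  shows "regular_epi C (\<eta> A)"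
proof -
  note \<eta> [simp] = reflection_unit(1-3)[OF F A]
  note univ = reflection_unit(4)[OF F A]
  obtain e m where "regular_factorization C (\<eta> A) e m"
    using C \<eta>(1) unfolding regular_category_def by blast
  then have e: "regular_epi C e" and m: "monic C m" and em [simp]: "Dom C m = Cod C e"
    and \<eta>_eq: "\<eta> A = m \<cdot> e" by (auto simp: regular_factorization_def)
  note [simp] = regular_epi_arrow[OF e] monic_arrow[OF m]
  have [simp]: "Dom C e = A" "Cod C m = on_ob F A" using \<eta>(2,3) \<eta>_eq by auto
  have FY: "on_ob F A \<in> Y" by (rule reflection_on_ob[OF F A])
  then have eY: "Cod C e \<in> Y" using closed[OF m] by simp
  obtain d where d [simp]: "d \<in> Ar C" "Dom C d = Cod C (\<eta> A)" "Cod C d = Cod C e"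
    and d\<eta>: "d \<cdot> \<eta> A = e"
    by (rule universal_arrow_factor[OF univ, of e]) (use eY in simp_all)
  have [simp]: "on_ob F A \<in> Ob C" using FY reflection_subset[OF F] by blast
  have "m \<cdot> d = Id C (on_ob F A)"
    by (rule universal_arrow_cancel[OF univ]) (use FY d\<eta> \<eta>_eq in simp_all)
  then have "isomorphism C m"
    by - (rule split_monic_isomorphism[OF m, of d], simp_all)
  then show ?thesis
    unfolding \<eta>_eq by (rule regular_epi_isomorphism_comp[OF e]) simp
qed

text \<open>Any monomorphism from \<open>A\<close> into an object of \<open>X\<close> factors through the unit.\<close>

lemma reflection_unit_monic:
  assumes F: "reflection C X F \<eta>" and A: "A \<in> subobject_closure C X"
  shows "monic C (\<eta> A)"
proof -
  have "A \<in> Ob C" using A subobject_closure_subset by blast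
  note \<eta> = reflection_unit[OF F this]
  obtain n where n: "monic C n" "Dom C n = A" "Cod C n \<in> X" by (rule subobject_closure_monic[OF A])
  obtain u where u: "u \<in> Ar C" "Dom C u = Cod C (\<eta> A)" "Cod C u = Cod C n" "u \<cdot> \<eta> A = n"
    by (rule universal_arrow_factor[OF \<eta>(4), of n]) (use n \<eta> monic_arrow[OF n(1)] in simp_all)
  show ?thesis by (rule monic_of_comp[of u]) (use n u \<eta> in simp_all)
qed

lemma reflection_section:
  assumes F: "reflection C S F \<eta>" and s: "section_of C s f"
  shows "section_of C (on_ar F s) (on_ar F f)"
proof -
  interpret F: is_functor C "full_subcategory C S" F by (rule reflection_functor[OF F])
  note f = section_ofD[OF s]
  have hom: "s \<in> hom C (Cod C f) (Dom C f)" "f \<in> hom C (Dom C f) (Cod C f)"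
    using f by (simp_all add: hom_def)
  have "on_ar F f \<cdot> on_ar F s = Id C (on_ob F (Cod C f))"
    using F.on_ar_comp[OF hom] f F.on_ar_Id[of "Cod C f"] by simp
  then show ?thesis
    by (intro section_ofI) (use f reflection_on_ar[OF F] in simp_all)
qed

text \<open>The comparison from \<open>F' A\<close> to \<open>F A\<close> is monic, so \<open>F' k\<close> is monic because \<open>F k\<close> is, being a
  kernel. Since the unit of \<open>F'\<close> is a regular epimorphism, \<open>F' f\<close> is a quotient of \<open>f\<close> as a split
  epimorphism, and the kernel of \<open>f\<close> maps onto the kernel of \<open>F' f\<close>. It does so through \<open>F' k\<close>,
  which is therefore that kernel.\<close>

lemma protoadditive_epi_part:
  assumes C: "homological C" and F: "protoadditive_reflection C X F \<eta>"
    and F': "reflection C (subobject_closure C X) F' \<eta>'"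
  shows "protoadditive_reflection C (subobject_closure C X) F' \<eta>'"
  unfolding protoadditive_reflection_def
proof (intro conjI allI impI)
  let ?Y = "subobject_closure C X"
  have RF: "reflection C X F \<eta>" using F by (simp add: protoadditive_reflection_def)
  obtain Z where Z: "zero_object C Z" using homologicalD(2)[OF C] unfolding pointed_def by blast
  have XY: "X \<subseteq> ?Y" by (rule subset_subobject_closure[OF reflection_subset[OF RF]])
  have "\<exists>m. m \<in> Ar C \<and> Dom C m = on_ob F' A \<and> Cod C m = on_ob F A \<and> m \<cdot> \<eta>' A = \<eta> A \<and> monic C m"
    if A: "A \<in> Ob C" for A
  proof -
    note [simp] = reflection_unit(1-3)[OF RF A] reflection_unit(1-3)[OF F' A]
    obtain m where m [simp]: "m \<in> Ar C" "Dom C m = Cod C (\<eta>' A)" "Cod C m = Cod C (\<eta> A)"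
      and m\<eta>': "m \<cdot> \<eta>' A = \<eta> A"
      by (rule universal_arrow_factor[OF reflection_unit(4)[OF F' A], of "\<eta> A"])
        (use reflection_on_ob[OF RF A] XY in auto)
    obtain n where n: "monic C n" "Dom C n = on_ob F' A" "Cod C n \<in> X"
      by (rule subobject_closure_monic[OF reflection_on_ob[OF F' A]])
    note [simp] = monic_arrow[OF n(1)] n(2)
    obtain g where g [simp]: "g \<in> Ar C" "Dom C g = Cod C (\<eta> A)" "Cod C g = Cod C (n \<cdot> \<eta>' A)"
      and g\<eta>: "g \<cdot> \<eta> A = n \<cdot> \<eta>' A"
      by (rule universal_arrow_factor[OF reflection_unit(4)[OF RF A], of "n \<cdot> \<eta>' A"])
        (use n in simp_all)
    \<comment> \<open>The embedding \<open>n\<close> of \<open>F' A\<close> into an object of \<open>X\<close> factors through the comparison \<open>m\<close>,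
      so \<open>m\<close> is monic.\<close>
    have "g \<cdot> m = n"
      by (rule universal_arrow_cancel[OF reflection_unit(4)[OF F' A]])
        (use m\<eta>' g\<eta> n(3) XY in auto)
    then have "monic C m" by - (rule monic_of_comp[of g], use n in simp_all)
    then show ?thesis using m\<eta>' by (intro exI[of _ m]) simp
  qed
  then obtain m where m: "\<And>A. A \<in> Ob C \<Longrightarrow> m A \<in> Ar C" "\<And>A. A \<in> Ob C \<Longrightarrow> Dom C (m A) = on_ob F' A"
    "\<And>A. A \<in> Ob C \<Longrightarrow> Cod C (m A) = on_ob F A" "\<And>A. A \<in> Ob C \<Longrightarrow> m A \<cdot> \<eta>' A = \<eta> A"
    "\<And>A. A \<in> Ob C \<Longrightarrow> monic C (m A)" by metis
  fix k f s assume kfs: "split_short_exact C k f s"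
  then have ker: "is_kernel C k f" and sec: "section_of C s f"
    by (auto simp: split_short_exact_def short_exact_def)
  define K A B where "K = Dom C k" and "A = Dom C f" and "B = Cod C f"
  note k [simp] = is_kernelD(1-3)[OF ker, folded A_def]
    and f [simp] = section_ofD(2-4)[OF sec, folded A_def B_def]
  have hom [simp]: "Dom C k = K" "Dom C f = A" "Cod C f = B"
    by (simp_all add: K_def A_def B_def)
  have Ob [simp]: "K \<in> Ob C" "A \<in> Ob C" "B \<in> Ob C"
    using Dom_Cod_Ob[OF k(1)] Dom_Cod_Ob[OF k(2)] by simp_all
  note [simp] = m(1-3)[OF Ob(1)] m(1-3)[OF Ob(2)]
    reflection_unit(1-3)[OF F' Ob(1)] reflection_unit(1-3)[OF F' Ob(2)]
    reflection_unit(1-3)[OF F' Ob(3)]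
  note F'k = reflection_on_ar[OF F' k(1), simplified]
    and F'f = reflection_on_ar[OF F' k(2), simplified]
    and F's = reflection_on_ar[OF F' f(1), simplified]
    and Fk = reflection_on_ar[OF RF k(1), simplified]
  note [simp] = F'k(1-3) F'f(1-3) F's(1-3) Fk(1-3)
  have "is_kernel (full_subcategory C X) (on_ar F k) (on_ar F f)"
    using F kfs unfolding protoadditive_reflection_def short_exact_def by blast
  from is_kernel_monic[OF is_kernel_reflective[OF RF Z this]]
  have "monic C (on_ar F k \<cdot> m K)" by (rule monic_comp[OF m(5)[OF Ob(1)]]) simp
  moreover have "m A \<cdot> on_ar F' k = on_ar F k \<cdot> m K"
  proof (rule universal_arrow_cancel[OF reflection_unit(4)[OF F' Ob(1)]])
    have "(m A \<cdot> on_ar F' k) \<cdot> \<eta>' K = (m A \<cdot> \<eta>' A) \<cdot> k" using F'k(4) by simp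
    also have "\<dots> = on_ar F k \<cdot> (m K \<cdot> \<eta>' K)" using Fk(4) m(4)[OF Ob(1)] m(4)[OF Ob(2)] by simp
    finally show "(m A \<cdot> on_ar F' k) \<cdot> \<eta>' K = (on_ar F k \<cdot> m K) \<cdot> \<eta>' K" by simp
    show "Cod C (on_ar F k \<cdot> m K) \<in> ?Y" using reflection_on_ob[OF RF Ob(2)] XY by auto
  qed simp_all
  ultimately have mono: "monic C (on_ar F' k)" by - (rule monic_of_comp[of "m A"], simp_all)
  have F'Y: "on_ob F' K \<in> ?Y" "on_ob F' A \<in> ?Y" "on_ob F' B \<in> ?Y"
    using reflection_on_ob[OF F'] by simp_all
  have YC: "?Y \<subseteq> Ob C" by (rule subobject_closure_subset)
  have F'Ob: "on_ob F' K \<in> Ob C" "on_ob F' B \<in> Ob C" using F'Y YC by auto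
  have zero: "zero_arrow C (on_ar F' f \<cdot> on_ar F' k)"
  proof -
    obtain z where z: "zero_arrow C z" "z \<in> Ar C" "Dom C z = on_ob F' K" "Cod C z = on_ob F' B"
      by (rule zero_arrow_exists[OF homologicalD(2)[OF C] F'Ob])
    have "(on_ar F' f \<cdot> on_ar F' k) \<cdot> \<eta>' K = \<eta>' B \<cdot> (f \<cdot> k)"
      using F'k(4) comp_extend[OF F'f(4), of k] by simp
    also have "\<dots> = z \<cdot> \<eta>' K"
      by (rule zero_arrow_unique[OF zero_arrow_comp_left[OF is_kernelD(4)[OF ker]]
            zero_arrow_comp_right[OF z(1)]]) (use z in simp_all)
    finally have "on_ar F' f \<cdot> on_ar F' k = z"
      by - (rule universal_arrow_cancel[OF reflection_unit(4)[OF F' Ob(1)]], use z F'Y in simp_all)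
    then show ?thesis using z(1) by simp
  qed
  have ker': "is_kernel C (on_ar F' k) (on_ar F' f)"
  proof (rule kernel_of_split_quotient[OF C ker sec])
    show "regular_epi C (\<eta>' A)"
      by (rule reflection_unit_regular_epi[OF homologicalD(3)[OF C] F' Ob(2)])
        (rule subobject_closure_closed)
    show "\<eta>' B \<cdot> f = on_ar F' f \<cdot> \<eta>' A" "\<eta>' A \<cdot> s = on_ar F' s \<cdot> \<eta>' B"
      "\<eta>' A \<cdot> k = on_ar F' k \<cdot> \<eta>' K"
      using F'f(4) F's(4) F'k(4) by simp_all
  qed (simp_all add: mono zero)
  have coker': "is_cokernel C (on_ar F' f) (on_ar F' k)"
    by (rule split_epi_is_cokernel[OF homologicalD(4)[OF C] homologicalD(1)[OF C] ker'
          reflection_section[OF F' sec]])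
  have ZY: "Z \<in> ?Y" by (rule reflection_zero_object[OF F' Z])
  show "short_exact (full_subcategory C ?Y) (on_ar F' k) (on_ar F' f)"
    unfolding short_exact_def
    using is_kernel_full_subcategory[OF Z ZY YC ker'] is_cokernel_full_subcategory[OF Z ZY YC coker']
      F'Y by simp
qed (rule F')

text \<open>The inclusion preserves the kernel and the section, and in \<open>C\<close> these force \<open>f\<close> to be a cokernel
  again. The splitting is essential, since the inclusion need not preserve cokernels: among
  torsion-free abelian groups, multiplication by 2 on the integers has cokernel 0.\<close>

lemma split_short_exact_reflective:
  assumes C: "homological C" and F: "reflection C S F \<eta>"
    and kfs: "split_short_exact (full_subcategory C S) k f s"
  shows "split_short_exact C k f s"
proof -
  obtain Z where Z: "zero_object C Z" using homologicalD(2)[OF C] unfolding pointed_def by blast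
  have ker: "is_kernel C k f"
    using is_kernel_reflective[OF F Z] kfs by (simp add: split_short_exact_def short_exact_def)
  have sec: "section_of C s f"
    using kfs by (simp add: split_short_exact_def section_of_full_subcategory)
  show ?thesis
    using ker sec split_epi_is_cokernel[OF homologicalD(4)[OF C] homologicalD(1)[OF C] ker sec]
    by (simp add: split_short_exact_def short_exact_def)
qed

text \<open>On \<open>Y\<close> the reflection onto \<open>X\<close> is the restriction of \<open>F\<close>, and a split short exact sequence
  of \<open>Y\<close> is one of \<open>C\<close>.\<close>

lemma protoadditive_mono_part:
  assumes C: "homological C" and F: "protoadditive_reflection C X F \<eta>"
    and F': "reflection C Y F' \<eta>'" and F'': "reflection (full_subcategory C Y) X F'' \<eta>''"
  shows "protoadditive_reflection (full_subcategory C Y) X F'' \<eta>''"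
proof -
  have RF: "reflection C X F \<eta>" using F by (simp add: protoadditive_reflection_def)
  have Y: "Y \<subseteq> Ob C" by (rule reflection_subset[OF F'])
  interpret Y: category "full_subcategory C Y" by (rule category_full_subcategory[OF Y])
  have X: "X \<subseteq> Y" using Y.reflection_subset[OF F''] by simp
  have "protoadditive_reflection (full_subcategory C Y) X F \<eta>"
    unfolding protoadditive_reflection_def full_subcategory_full_subcategory[OF X]
    using reflection_restrict[OF RF X Y] F split_short_exact_reflective[OF C F']
    unfolding protoadditive_reflection_def by blast
  then show ?thesis using F'' by (rule Y.protoadditive_reflection_unique)
qed

lemma protoadditive_comp:
  assumes F': "protoadditive_reflection C Y F' \<eta>'"
    and F'': "protoadditive_reflection (full_subcategory C Y) X F'' \<eta>''" and X: "replete C X"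
  shows "protoadditive_reflection C X (comp_func F'' F') (\<lambda>A. \<eta>'' (on_ob F' A) \<cdot> \<eta>' A)"
  unfolding protoadditive_reflection_def
proof (intro conjI allI impI)
  have RF': "reflection C Y F' \<eta>'" and RF'': "reflection (full_subcategory C Y) X F'' \<eta>''"
    using F' F'' by (simp_all add: protoadditive_reflection_def)
  show "reflection C X (comp_func F'' F') (\<lambda>A. \<eta>'' (on_ob F' A) \<cdot> \<eta>' A)"
    by (rule reflection_comp[OF RF' RF'' X])
  interpret Y: category "full_subcategory C Y"
    by (rule category_full_subcategory[OF reflection_subset[OF RF']])
  have XY: "X \<subseteq> Y" using Y.reflection_subset[OF RF''] by simp
  fix k f s assume kfs: "split_short_exact C k f s"
  then have sec: "section_of C s f" by (simp add: split_short_exact_def)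
  have "on_ob F' (Dom C f) \<in> Y" "on_ob F' (Cod C f) \<in> Y"
    using reflection_on_ob[OF RF'] section_ofD(1)[OF sec] by simp_all
  then have "split_short_exact (full_subcategory C Y) (on_ar F' k) (on_ar F' f) (on_ar F' s)"
    using F' kfs reflection_section[OF RF' sec] reflection_on_ar[OF RF' section_ofD(1)[OF sec]]
    by (auto simp: protoadditive_reflection_def split_short_exact_def section_of_full_subcategory)
  then have "short_exact (full_subcategory C X) (on_ar F'' (on_ar F' k)) (on_ar F'' (on_ar F' f))"
    using F'' unfolding protoadditive_reflection_def full_subcategory_full_subcategory[OF XY]
    by blast
  then show "short_exact (full_subcategory C X) (on_ar (comp_func F'' F') k)
      (on_ar (comp_func F'' F') f)"
    by (simp add: comp_func_def)
qed

end

section \<open>Factorization of protoadditive reflections\<close>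

theorem theorem2p10:
  fixes C :: "('o, 'm) cat" and X Y :: "'o set"
    and F :: "('o, 'm, 'o, 'm) func" and \<eta> :: "'o \<Rightarrow> 'm"
  assumes "homological C"
    and "reflection C X F \<eta>"
    and "Y = subobject_closure C X"
  shows "(\<exists>F' \<eta>'. reflection C Y F' \<eta>') \<and>
    (\<exists>F'' \<eta>''. reflection (full_subcategory C Y) X F'' \<eta>'') \<and>
    (\<forall>F' \<eta>' F'' \<eta>''.
      reflection C Y F' \<eta>' \<and> reflection (full_subcategory C Y) X F'' \<eta>'' \<longrightarrow>
      naturally_isomorphic C (full_subcategory C X) F (comp_func F'' F') \<and>
      regular_epi_reflection C Y F' \<eta>' \<and>
      monoreflection (full_subcategory C Y) X F'' \<eta>'' \<and>
      (protoadditive_reflection C X F \<eta> \<longleftrightarrow>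
        protoadditive_reflection C Y F' \<eta>' \<and>
        protoadditive_reflection (full_subcategory C Y) X F'' \<eta>''))"
proof (intro conjI allI impI)
  interpret category C using assms(1) by (simp add: homological_def)
  note C = assms(1) and F = assms(2) and Y_def = assms(3)
  have Y: "Y \<subseteq> Ob C" and X: "X \<subseteq> Y" and replete: "replete C X"
    using subobject_closure_subset[of X] subset_subobject_closure[OF reflection_subset[OF F]]
      reflection_replete[OF F] by (simp_all add: Y_def)
  interpret Y: category "full_subcategory C Y" by (rule category_full_subcategory[OF Y])
  show "\<exists>F' \<eta>'. reflection C Y F' \<eta>'"
    unfolding Y_def by (rule reflection_subobject_closure_exists[OF homologicalD(3)[OF C] F])
  show "\<exists>F'' \<eta>''. reflection (full_subcategory C Y) X F'' \<eta>''"
    using reflection_restrict[OF F X Y] by blast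
  fix F' \<eta>' F'' \<eta>''
  assume "reflection C Y F' \<eta>' \<and> reflection (full_subcategory C Y) X F'' \<eta>''"
  then have F': "reflection C Y F' \<eta>'" and F'': "reflection (full_subcategory C Y) X F'' \<eta>''"
    by simp_all
  note comp = reflection_comp[OF F' F'' replete]
  show "naturally_isomorphic C (full_subcategory C X) F (comp_func F'' F')"
    by (rule reflections_naturally_isomorphic[OF F comp])
  show "regular_epi_reflection C Y F' \<eta>'"
    unfolding regular_epi_reflection_def
    using F' reflection_unit_regular_epi[OF homologicalD(3)[OF C] F'] subobject_closure_closed
    by (simp add: Y_def)
  show "monoreflection (full_subcategory C Y) X F'' \<eta>''"
    unfolding monoreflection_def
  proof (intro conjI ballI)
    fix A assume "A \<in> Ob (full_subcategory C Y)"
    then have A: "A \<in> Y" by simp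
    then obtain n where n: "monic C n" "Dom C n = A" "Cod C n \<in> X"
      unfolding Y_def by (rule subobject_closure_monic)
    have "monic (full_subcategory C Y) n"
      by (rule monic_full_subcategory) (use n A X in auto)
    then have "A \<in> subobject_closure (full_subcategory C Y) X"
      using A n X monic_arrow[OF n(1)] unfolding subobject_closure_def hom_def by auto
    then show "monic (full_subcategory C Y) (\<eta>'' A)" by (rule Y.reflection_unit_monic[OF F''])
  qed (rule F'')
  show "protoadditive_reflection C X F \<eta> \<longleftrightarrow>
    protoadditive_reflection C Y F' \<eta>' \<and>
    protoadditive_reflection (full_subcategory C Y) X F'' \<eta>''"
  proof (intro iffI conjI)
    assume PF: "protoadditive_reflection C X F \<eta>"
    show "protoadditive_reflection C Y F' \<eta>'"
      using protoadditive_epi_part[OF C PF] F' by (simp add: Y_def)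
    show "protoadditive_reflection (full_subcategory C Y) X F'' \<eta>''"
      by (rule protoadditive_mono_part[OF C PF F' F''])
  next
    assume "protoadditive_reflection C Y F' \<eta>' \<and>
      protoadditive_reflection (full_subcategory C Y) X F'' \<eta>''"
    then have "protoadditive_reflection C X (comp_func F'' F')
        (\<lambda>A. \<eta>'' (on_ob F' A) \<cdot>\<^bsub>C\<^esub> \<eta>' A)"
      using protoadditive_comp[OF _ _ replete] by blast
    then show "protoadditive_reflection C X F \<eta>"
      using F by (rule protoadditive_reflection_unique)
  qed
qed

end
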